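(* Let $U$ be a subgroup of finite index in Thompson's group $F$. Then $U$ is isomorphic to $F$ if and only if $U=[p,q]$ for some positive integers $p$ and $q$.
   Context: Thompson's group $F$ is regarded as the group (under composition) of all order-preserving homeomorphisms $f\colon\mathbb{R}\to\mathbb{R}$ that are piecewise linear with a discrete set of breakpoints (finitely many in every bounded interval), all breakpoints in $\mathbb{Z}[\frac12]$, all slopes integral powers of $2$, $f(\mathbb{Z}[\frac12])\subset\mathbb{Z}[\frac12]$, and for which there exist integers $l,r$ and a real $M>0$ with $f(t)=t+r$ for all $t>M$ and $f(t)=t+l$ for all $t<-M$. The map $f\mapsto(l,r)$ is the abelianization homomorphism $F\to\mathbb{Z}\times\mathbb{Z}$. For integers $p,q$, $[p,q]$ denotes the preimage in $F$ of the subgroup $p\mathbb{Z}\times q\mathbb{Z}$ of $\mathbb{Z}\times\mathbb{Z}$ under the abelianization homomorphism. *)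

theory Defs
  imports "HOL-Analysis.Analysis" "HOL-Algebra.Algebra"
begin

definition dyadic :: "real set" where
  "dyadic = {of_int a / 2 ^ n | (a::int) (n::nat). True}"

definition affine_near :: "(real \<Rightarrow> real) \<Rightarrow> real \<Rightarrow> real \<Rightarrow> real \<Rightarrow> bool" where
  "affine_near f m c x \<longleftrightarrow> (\<forall>\<^sub>F y in nhds x. f y = m * y + c)"

definition breakpoints :: "(real \<Rightarrow> real) \<Rightarrow> real set" where
  "breakpoints f = {x. \<nexists>m c. affine_near f m c x}"

definition slopes :: "(real \<Rightarrow> real) \<Rightarrow> real set" where
  "slopes f = {m. \<exists>x c. affine_near f m c x}"

definition translation_left :: "(real \<Rightarrow> real) \<Rightarrow> int \<Rightarrow> bool" where
  "translation_left f l \<longleftrightarrow> (\<exists>M>0. \<forall>t. t < - M \<longrightarrow> f t = t + of_int l)"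

definition translation_right :: "(real \<Rightarrow> real) \<Rightarrow> int \<Rightarrow> bool" where
  "translation_right f r \<longleftrightarrow> (\<exists>M>0. \<forall>t. t > M \<longrightarrow> f t = t + of_int r)"

text \<open>Piecewise linearity is the finiteness condition on
  \<^const>\<open>breakpoints\<close>, as \<open>f\<close> is locally affine off that set.\<close>

definition thompson_F :: "(real \<Rightarrow> real) monoid" where
  "thompson_F =
    \<lparr>carrier = {f. strict_mono f \<and> (\<exists>g. homeomorphism UNIV UNIV f g)
        \<and> (\<forall>a b. finite (breakpoints f \<inter> {a..b}))
        \<and> breakpoints f \<subseteq> dyadic
        \<and> slopes f \<subseteq> range (\<lambda>k::int. 2 powi k)
        \<and> f ` dyadic \<subseteq> dyadic
        \<and> (\<exists>l. translation_left f l) \<and> (\<exists>r. translation_right f r)},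
     mult = (\<circ>), one = id\<rparr>"

text \<open>The abelianization homomorphism \<open>f \<mapsto> (l, r)\<close>. On elements of
  \<^const>\<open>thompson_F\<close> both integers exist and are unique.\<close>

definition thompson_ab :: "(real \<Rightarrow> real) \<Rightarrow> int \<times> int" where
  "thompson_ab f = (THE l. translation_left f l, THE r. translation_right f r)"

text \<open>The preimage \<open>[p,q]\<close> of \<open>p\<int> \<times> q\<int>\<close> under the abelianization.\<close>

definition thompson_sub :: "int \<Rightarrow> int \<Rightarrow> (real \<Rightarrow> real) set" where
  "thompson_sub p q =
    {f \<in> carrier thompson_F. thompson_ab f \<in> range ((*) p) \<times> range ((*) q)}"

end

theory Submission imports Defs begin

text \<open>
  Conjugation by a piecewise linear homeomorphism \<open>v\<close> with \<open>v (t + q) = v t + 1\<close> near \<open>\<infinity>\<close> and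
  \<open>v (t + p) = v t + 1\<close> near \<open>-\<infinity>\<close> carries \<open>[p, q]\<close> onto \<open>F\<close>.

  For the converse, let \<open>K\<close> be the kernel of the abelianization. The group \<open>F\<close> is generated by
  the unit translation and its conjugates of one contraction \<open>y\<close>, and the relations between them
  make every quotient of finite exponent abelian and generated by the images of \<open>y\<close> and the
  translation. Hence \<open>K\<close> lies in the subgroup generated by the \<open>N\<close>-th powers of \<open>F\<close>, for every
  \<open>N > 0\<close>. If \<open>U\<close> has finite index, it contains all \<open>M\<close>-th powers for some \<open>M > 0\<close>, so that \<open>K\<close>
  is the intersection over \<open>N\<close> of the subgroups generated by the \<open>N\<close>-th powers of \<open>U\<close>, and every
  isomorphism between \<open>F\<close> and \<open>U\<close> maps \<open>K\<close> to itself. An element \<open>f\<close> of \<open>U\<close> has a trivial end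
  translation iff every element of \<open>f K\<close> commutes with a nontrivial element of \<open>K\<close>; so
  isomorphisms preserve this property too. As each element of \<open>F\<close> is a product of two such
  elements, one trivial at each end, the image of \<open>U\<close> in \<open>\<int> \<times> \<int>\<close> is a product of two
  subgroups of \<open>\<int>\<close>.
\<close>

section \<open>Dyadic rationals\<close>

lemma dyadic_iff: "x \<in> dyadic \<longleftrightarrow> (\<exists>n. x * 2 ^ n \<in> \<int>)"
proof
  assume "x \<in> dyadic"
  then obtain a n where "x = of_int a / 2 ^ n" by (auto simp: dyadic_def)
  then have "x * 2 ^ n = of_int a" by simp
  then show "\<exists>n. x * 2 ^ n \<in> \<int>" by (metis Ints_of_int)
next
  assume "\<exists>n. x * 2 ^ n \<in> \<int>"
  then obtain n a where "x * 2 ^ n = of_int a" by (auto elim: Ints_cases)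
  then have "x = of_int a / 2 ^ n" by (simp add: field_simps)
  then show "x \<in> dyadic" by (auto simp: dyadic_def)
qed

lemma dyadic_scaled_Ints_mono: "x * 2 ^ n \<in> \<int> \<Longrightarrow> n \<le> m \<Longrightarrow> x * 2 ^ m \<in> (\<int> :: real set)"
proof -
  assume a: "x * 2 ^ n \<in> \<int>" "n \<le> m"
  have "x * 2 ^ m = (x * 2 ^ n) * 2 ^ (m - n)"
    using a(2) by (simp add: mult.assoc flip: power_add)
  moreover have "\<dots> \<in> \<int>" by (intro Ints_mult a(1) Ints_power Ints_numeral)
  ultimately show ?thesis by (simp only:)
qed

lemma dyadic_of_int [simp]: "of_int a \<in> dyadic"
  unfolding dyadic_iff by (rule exI [of _ 0]) simp

lemma dyadic_0 [simp]: "0 \<in> dyadic" and dyadic_1 [simp]: "1 \<in> dyadic"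
  using dyadic_of_int [of 0] dyadic_of_int [of 1] by simp_all

lemma dyadic_add [simp]: "x \<in> dyadic \<Longrightarrow> y \<in> dyadic \<Longrightarrow> x + y \<in> dyadic"
proof -
  assume "x \<in> dyadic" "y \<in> dyadic"
  then obtain n m where "x * 2 ^ n \<in> \<int>" "y * 2 ^ m \<in> \<int>" by (auto simp: dyadic_iff)
  then have "x * 2 ^ max n m \<in> \<int>" "y * 2 ^ max n m \<in> \<int>"
    by (meson dyadic_scaled_Ints_mono max.cobounded1 max.cobounded2)+
  then have "(x + y) * 2 ^ max n m \<in> \<int>" by (simp add: ring_distribs)
  then show ?thesis by (auto simp: dyadic_iff)
qed

lemma dyadic_mult [simp]: "x \<in> dyadic \<Longrightarrow> y \<in> dyadic \<Longrightarrow> x * y \<in> dyadic"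
proof -
  assume "x \<in> dyadic" "y \<in> dyadic"
  then obtain n m where "x * 2 ^ n \<in> \<int>" "y * 2 ^ m \<in> \<int>" by (auto simp: dyadic_iff)
  then have "(x * 2 ^ n) * (y * 2 ^ m) \<in> \<int>" by simp
  then have "(x * y) * 2 ^ (n + m) \<in> \<int>" by (simp add: power_add ac_simps)
  then show ?thesis by (auto simp: dyadic_iff)
qed

lemma dyadic_minus [simp]: "x \<in> dyadic \<Longrightarrow> - x \<in> dyadic"
  using dyadic_mult [OF dyadic_of_int [of "-1"]] by simp

lemma dyadic_diff [simp]: "x \<in> dyadic \<Longrightarrow> y \<in> dyadic \<Longrightarrow> x - y \<in> dyadic"
  using dyadic_add [OF _ dyadic_minus, of x y] by simp

lemma dyadic_powi [simp]: "2 powi k \<in> dyadic"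
proof (cases "k \<ge> 0")
  case True
  then have "(2::real) powi k = of_int (2 ^ nat k)" by (simp add: power_int_def)
  then show ?thesis by (metis dyadic_of_int)
next
  case False
  then have "(2::real) powi k = of_int 1 / 2 ^ nat (- k)"
    by (simp add: power_int_def field_simps)
  then show ?thesis unfolding dyadic_def by blast
qed

lemma dyadic_dense:
  assumes "a < (b::real)" shows "\<exists>y\<in>dyadic. a < y \<and> y < b"
proof -
  obtain n where n: "(1/2) ^ n < b - a"
    using real_arch_pow_inv [of "b - a" "1/2"] assms by auto
  have less: "a * 2 ^ n + 1 < b * 2 ^ n"
    using n by (simp add: power_divide field_simps)
  define y where "y = of_int (\<lfloor>a * 2 ^ n\<rfloor> + 1) / (2 ^ n :: real)"
  have "a * 2 ^ n < of_int (\<lfloor>a * 2 ^ n\<rfloor> + 1)" "of_int (\<lfloor>a * 2 ^ n\<rfloor> + 1) < b * 2 ^ n"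
    using less by linarith+
  then have "a < y" "y < b"
    unfolding y_def
      by (simp_all only: pos_less_divide_eq pos_divide_less_eq zero_less_power zero_less_numeral)
  moreover have "y \<in> dyadic" unfolding y_def dyadic_def by blast
  ultimately show ?thesis by blast
qed

section \<open>Piecewise linear dyadic homeomorphisms of the line\<close>

definition locally_finite_set :: "real set \<Rightarrow> bool" where
  "locally_finite_set B \<longleftrightarrow> (\<forall>a b. finite (B \<inter> {a..b}))"

text \<open>End behaviour is left out because the rescaling maps used later belong here but in
  general not to \<open>thompson_F\<close>. The set \<open>B\<close> may be larger than the set of
  breakpoints, so unions and preimages can serve as witnesses. Dyadic intercepts, with the condition
  on \<open>B\<close>, encode that dyadic points go to dyadic points.\<close>

definition pl2 :: "(real \<Rightarrow> real) set" where
  "pl2 = {f. strict_mono f \<and> surj f \<and> (\<exists>B\<subseteq>dyadic. locally_finite_set B \<and> f ` B \<subseteq> dyadic \<and>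
     (\<forall>x. x \<notin> B \<longrightarrow> (\<exists>k c. c \<in> dyadic \<and> affine_near f (2 powi k) c x)))}"

abbreviation finv :: "(real \<Rightarrow> real) \<Rightarrow> real \<Rightarrow> real" where
  "finv \<equiv> inv_into UNIV"

lemma affine_near_unique:
  assumes "affine_near f m c x" "affine_near f m' c' x"
  shows "m = m'" "c = c'"
proof -
  have "\<forall>\<^sub>F y in nhds x. m * y + c = m' * y + c'"
    using assms unfolding affine_near_def by eventually_elim auto
  then obtain e where e: "e > 0" "\<And>y. dist y x < e \<Longrightarrow> m * y + c = m' * y + c'"
    by (auto simp: eventually_nhds_metric)
  have 1: "m * x + c = m' * x + c'" using e by auto
  have "m * (x + e/2) + c = m' * (x + e/2) + c'" using e by (auto simp: dist_real_def)
  then have "m * (e/2) = m' * (e/2)" using 1 unfolding distrib_left by linarith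
  then show "m = m'" using e by simp
  then show "c = c'" using 1 by simp
qed

lemma affine_near_eventually:
  "affine_near f m c x \<Longrightarrow> \<forall>\<^sub>F y in nhds x. affine_near f m c y"
  unfolding affine_near_def by (simp add: eventually_eventually)

text \<open>An interval is infinite while \<open>B\<close> meets it in finitely many points. Serves
  to move a local slope from a point of the exceptional set to a nearby point outside it.\<close>

lemma locally_finite_avoid:
  assumes "locally_finite_set B" "\<forall>\<^sub>F y in nhds (x::real). P y"
  shows "\<exists>y. y \<notin> B \<and> P y"
proof -
  obtain e where e: "e > 0" "\<And>y. dist y x < e \<Longrightarrow> P y"
    using assms(2) by (auto simp: eventually_nhds_metric)
  have "infinite {x..<x+e}" using e(1) by simp
  moreover have "finite (B \<inter> {x..x+e})" using assms(1) by (auto simp: locally_finite_set_def)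
  ultimately have "\<not> {x..<x+e} \<subseteq> B"
    using finite_subset [of "{x..<x+e}" "B \<inter> {x..x+e}"] atLeastLessThan_subseteq_atLeastAtMost_iff
    by (metis Int_subset_iff order_refl)
  then obtain y where "y \<in> {x..<x+e}" "y \<notin> B" by blast
  then show ?thesis using e(2) [of y] by (auto simp: dist_real_def)
qed

lemma continuous_strict_mono_surj:
  assumes "strict_mono (f::real\<Rightarrow>real)" "surj f" shows "continuous_on UNIV f"
  using assms(2) by (intro continuous_onI_mono) (simp_all add: strict_mono_less_eq [OF assms(1)])

lemma strict_mono_inv_real:
  assumes "strict_mono (f::real\<Rightarrow>real)" "surj f" shows "strict_mono (finv f)"
proof (rule strict_monoI)
  fix x y :: real assume "x < y"
  then have "f (finv f x) < f (finv f y)" by (simp add: surj_f_inv_f [OF assms(2)])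
  then show "finv f x < finv f y" by (simp add: strict_mono_less [OF assms(1)])
qed

lemma surj_inv_strict_mono:
  assumes "strict_mono (f::real\<Rightarrow>real)" shows "surj (finv f)"
  using assms by (simp add: inj_imp_surj_inv strict_mono_imp_inj_on)

lemma homeomorphism_strict_mono:
  assumes "strict_mono (f::real\<Rightarrow>real)" "surj f"
  shows "homeomorphism UNIV UNIV f (finv f)"
proof -
  note smi = strict_mono_inv_real [OF assms] and sui = surj_inv_strict_mono [OF assms(1)]
  show ?thesis
    unfolding homeomorphism_def
    using assms(2) sui strict_mono_imp_inj_on [OF assms(1)]
      continuous_strict_mono_surj [OF assms] continuous_strict_mono_surj [OF smi sui]
    by (simp add: surj_f_inv_f)
qed

text \<open>The intercept of an affine piece is dyadic because it can be computed at a dyadic point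
  of the piece. Conversely, a slope at a point of the exceptional set also occurs at a point outside
  it.\<close>

lemma carrier_thompson_F:
  "carrier thompson_F =
    {f \<in> pl2. (\<exists>l. translation_left f l) \<and> (\<exists>r. translation_right f r)}"
proof -
  have "strict_mono f \<and> (\<exists>g. homeomorphism UNIV UNIV f g)
        \<and> (\<forall>a b. finite (breakpoints f \<inter> {a..b}))
        \<and> breakpoints f \<subseteq> dyadic
        \<and> slopes f \<subseteq> range (\<lambda>k::int. 2 powi k)
        \<and> f ` dyadic \<subseteq> dyadic \<longleftrightarrow> f \<in> pl2" (is "?L \<longleftrightarrow> ?R") for f
  proof
    assume L: ?L
    have "\<exists>k c. c \<in> dyadic \<and> affine_near f (2 powi k) c x" if x: "x \<notin> breakpoints f" for x
    proof -
      obtain m c where mc: "affine_near f m c x"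
        using x by (auto simp: breakpoints_def)
      then have "m \<in> slopes f" by (auto simp: slopes_def)
      then obtain k where k: "m = 2 powi k" using L by auto
      obtain e where e: "e > 0" "\<And>y. dist y x < e \<Longrightarrow> f y = m * y + c"
        using mc by (auto simp: affine_near_def eventually_nhds_metric)
      obtain y where y: "y \<in> dyadic" "x < y" "y < x + e"
        using dyadic_dense [of x "x + e"] e by auto
      have "c = f y - m * y" using e(2) [of y] y by (auto simp: dist_real_def)
      moreover have "f y \<in> dyadic" using L y by auto
      ultimately have "c \<in> dyadic" using y k by auto
      then show ?thesis using mc k by blast
    qed
    moreover have "surj f" using L by (auto simp: homeomorphism_def)
    moreover have "f ` breakpoints f \<subseteq> dyadic" using L by blast
    ultimately show ?R using L unfolding pl2_def locally_finite_set_def by blast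
  next
    assume ?R
    then obtain B where f: "strict_mono f" "surj f" "B \<subseteq> dyadic" "locally_finite_set B"
      "f ` B \<subseteq> dyadic" and aff: "\<And>x. x \<notin> B \<Longrightarrow> \<exists>k c. c \<in> dyadic \<and> affine_near f (2 powi k) c x"
      by (auto simp: pl2_def)
    have sub: "breakpoints f \<subseteq> B" using aff by (auto simp: breakpoints_def)
    have "slopes f \<subseteq> range (\<lambda>k::int. 2 powi k)"
    proof
      fix m assume "m \<in> slopes f"
      then obtain x c where "affine_near f m c x" by (auto simp: slopes_def)
      then obtain y where "y \<notin> B" "affine_near f m c y"
        using locally_finite_avoid [OF f(4) affine_near_eventually] by blast
      then show "m \<in> range (\<lambda>k::int. 2 powi k)"
        using aff affine_near_unique(1) by blast
    qed
    moreover have "f y \<in> dyadic" if "y \<in> dyadic" for y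
    proof (cases "y \<in> B")
      case False
      then obtain k c where "c \<in> dyadic" "affine_near f (2 powi k) c y" using aff by blast
      then show ?thesis using that by (auto simp: affine_near_def dest: eventually_nhds_x_imp_x)
    qed (use f in auto)
    moreover have "finite (breakpoints f \<inter> {a..b})" for a b
      using f(4) sub by (meson finite_subset inf_mono locally_finite_set_def order_refl)
    ultimately show ?L
      using f sub homeomorphism_strict_mono by blast
  qed
  then show ?thesis unfolding thompson_F_def by (simp only: partial_object.simps) blast
qed

lemma mult_thompson_F [simp]: "f \<otimes>\<^bsub>thompson_F\<^esub> g = f \<circ> g"
  and one_thompson_F [simp]: "\<one>\<^bsub>thompson_F\<^esub> = id"
  by (simp_all add: thompson_F_def)

lemma pl2_strict_mono: "f \<in> pl2 \<Longrightarrow> strict_mono f"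
  and pl2_surj: "f \<in> pl2 \<Longrightarrow> surj f"
  and pl2_inj: "f \<in> pl2 \<Longrightarrow> inj f"
  by (auto simp: pl2_def strict_mono_imp_inj_on)

text \<open>Powers of 2 are invertible among the dyadic numbers, so an affine piece with dyadic
  intercept can be solved for \<open>x\<close>. The backward direction makes preimages of
  breakpoints dyadic.\<close>

lemma pl2_dyadic_iff:
  assumes "f \<in> pl2" shows "f x \<in> dyadic \<longleftrightarrow> x \<in> dyadic"
proof -
  obtain B where f: "B \<subseteq> dyadic" "f ` B \<subseteq> dyadic"
    and aff: "\<And>x. x \<notin> B \<Longrightarrow> \<exists>k c. c \<in> dyadic \<and> affine_near f (2 powi k) c x"
    using assms by (auto simp: pl2_def)
  show ?thesis
  proof (cases "x \<in> B")
    case False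
    then obtain k c where kc: "c \<in> dyadic" "affine_near f (2 powi k) c x" using aff by blast
    then have e: "f x = 2 powi k * x + c"
      by (auto simp: affine_near_def dest: eventually_nhds_x_imp_x)
    then have "x = 2 powi (- k) * (f x - c)" by (simp add: power_int_minus)
    then show ?thesis using e kc by (metis dyadic_add dyadic_diff dyadic_mult dyadic_powi)
  qed (use f in auto)
qed

lemma pl2_comp:
  assumes "f \<in> pl2" "g \<in> pl2" shows "f \<circ> g \<in> pl2"
proof -
  obtain B where B: "B \<subseteq> dyadic" "locally_finite_set B" "f ` B \<subseteq> dyadic"
    and f: "\<And>x. x \<notin> B \<Longrightarrow> \<exists>k c. c \<in> dyadic \<and> affine_near f (2 powi k) c x"
    using assms(1) by (auto simp: pl2_def)
  obtain C where C: "C \<subseteq> dyadic" "locally_finite_set C"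
    and g: "\<And>x. x \<notin> C \<Longrightarrow> \<exists>k c. c \<in> dyadic \<and> affine_near g (2 powi k) c x"
    using assms(2) by (auto simp: pl2_def)
  note sm = pl2_strict_mono [OF assms(1)] pl2_strict_mono [OF assms(2)]
  note su = pl2_surj [OF assms(1)] pl2_surj [OF assms(2)]
  \<comment> \<open>A composite can fail to be affine only where \<open>g\<close> does or where
    \<open>g\<close> hits the exceptional set of \<open>f\<close>.\<close>
  let ?D = "C \<union> g -` B"
  have "?D \<subseteq> dyadic" using B(1) C(1) pl2_dyadic_iff [OF assms(2)] by auto
  moreover have "locally_finite_set ?D"
  proof -
    have "finite (?D \<inter> {a..b})" for a b
    proof -
      have "?D \<inter> {a..b} \<subseteq> (C \<inter> {a..b}) \<union> g -` (B \<inter> {g a..g b})"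
        using sm(2) by (auto simp: strict_mono_less_eq)
      moreover have "finite (g -` (B \<inter> {g a..g b}))"
        using B(2) pl2_inj [OF assms(2)]
          by (intro finite_vimageI) (auto simp: locally_finite_set_def)
      ultimately show ?thesis
        using C(2) unfolding locally_finite_set_def by (meson finite_UnI finite_subset)
    qed
    then show ?thesis by (auto simp: locally_finite_set_def)
  qed
  moreover have "(f \<circ> g) ` ?D \<subseteq> dyadic"
    using calculation(1) pl2_dyadic_iff [OF assms(2)] pl2_dyadic_iff [OF assms(1)] by auto
  moreover have "\<exists>k c. c \<in> dyadic \<and> affine_near (f \<circ> g) (2 powi k) c x" if x: "x \<notin> ?D" for x
  proof -
    obtain k c where kc: "c \<in> dyadic" "affine_near g (2 powi k) c x" using x g by blast
    obtain k' c' where kc': "c' \<in> dyadic" "affine_near f (2 powi k') c' (g x)" using x f by blast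
    have "filterlim g (nhds (g x)) (nhds x)"
      using continuous_strict_mono_surj [OF sm(2) su(2)]
      by (metis UNIV_I continuous_on_def tendsto_nhds_iff at_within_open open_UNIV)
    then have "\<forall>\<^sub>F y in nhds x. f (g y) = 2 powi k' * g y + c'"
      using kc'(2) unfolding affine_near_def by (rule eventually_compose_filterlim [rotated])
    then have "\<forall>\<^sub>F y in nhds x. (f \<circ> g) y = 2 powi (k' + k) * y + (2 powi k' * c + c')"
      using kc(2) unfolding affine_near_def
      by eventually_elim (simp add: power_int_add algebra_simps)
    then show ?thesis using kc kc' unfolding affine_near_def
      by (metis dyadic_add dyadic_mult dyadic_powi)
  qed
  moreover have "strict_mono (f \<circ> g)" using sm by (auto simp: strict_mono_def)
  moreover have "surj (f \<circ> g)" by (rule comp_surj [OF su(2) su(1)])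
  ultimately show ?thesis unfolding pl2_def by blast
qed

lemma pl2_inv:
  assumes "f \<in> pl2" shows "finv f \<in> pl2"
proof -
  obtain B where B: "B \<subseteq> dyadic" "locally_finite_set B" "f ` B \<subseteq> dyadic"
    and f: "\<And>x. x \<notin> B \<Longrightarrow> \<exists>k c. c \<in> dyadic \<and> affine_near f (2 powi k) c x"
    using assms(1) by (auto simp: pl2_def)
  note sm = pl2_strict_mono [OF assms] and su = pl2_surj [OF assms] and ij = pl2_inj [OF assms]
  note smi = strict_mono_inv_real [OF sm su]
  note sui = surj_inv_strict_mono [OF sm]
  have "locally_finite_set (f ` B)"
  proof -
    have "f ` B \<inter> {a..b} \<subseteq> f ` (B \<inter> {finv f a..finv f b})" for a b
    proof
      fix z assume "z \<in> f ` B \<inter> {a..b}"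
      then obtain x where "z = f x" "x \<in> B" "a \<le> f x" "f x \<le> b" by auto
      then show "z \<in> f ` (B \<inter> {finv f a..finv f b})"
        using strict_mono_less_eq [OF smi, of a "f x"] strict_mono_less_eq [OF smi, of "f x" b]
        by (simp add: inv_f_f [OF ij])
    qed
    then show ?thesis using B(2) unfolding locally_finite_set_def
      by (meson finite_imageI finite_subset)
  qed
  moreover have "finv f ` f ` B \<subseteq> dyadic" using B(1) ij by auto
  moreover have "\<exists>k c. c \<in> dyadic \<and> affine_near (finv f) (2 powi k) c z" if z: "z \<notin> f ` B" for z
  proof -
    have "finv f z \<notin> B" using z surj_f_inv_f [OF su, of z] by force
    then obtain k c where kc: "c \<in> dyadic" "affine_near f (2 powi k) c (finv f z)" using f by blast
    have "filterlim (finv f) (nhds (finv f z)) (nhds z)"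
      using continuous_strict_mono_surj [OF smi sui]
      by (metis UNIV_I continuous_on_def tendsto_nhds_iff at_within_open open_UNIV)
    then have "\<forall>\<^sub>F y in nhds z. f (finv f y) = 2 powi k * finv f y + c"
      using kc(2) unfolding affine_near_def by (rule eventually_compose_filterlim [rotated])
    then have "\<forall>\<^sub>F y in nhds z. finv f y = 2 powi (- k) * y + (- (2 powi (- k) * c))"
      by eventually_elim (use su in \<open>simp add: surj_f_inv_f power_int_minus field_simps\<close>)
    then show ?thesis using kc unfolding affine_near_def
      by (metis dyadic_minus dyadic_mult dyadic_powi)
  qed
  ultimately show ?thesis using B(3) smi sui unfolding pl2_def by blast
qed

section \<open>The end translations\<close>

abbreviation lshift :: "(real \<Rightarrow> real) \<Rightarrow> int" where "lshift f \<equiv> fst (thompson_ab f)"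
abbreviation rshift :: "(real \<Rightarrow> real) \<Rightarrow> int" where "rshift f \<equiv> snd (thompson_ab f)"

lemma translation_left_iff: "translation_left f l \<longleftrightarrow> (\<exists>N. \<forall>t\<le>N. f t = t + of_int l)"
proof
  assume "translation_left f l"
  then obtain M where "\<And>t. t < - M \<Longrightarrow> f t = t + of_int l" by (auto simp: translation_left_def)
  then show "\<exists>N. \<forall>t\<le>N. f t = t + of_int l" by (intro exI [of _ "- M - 1"]) auto
next
  assume "\<exists>N. \<forall>t\<le>N. f t = t + of_int l"
  then obtain N where "\<And>t. t \<le> N \<Longrightarrow> f t = t + of_int l" by blast
  then show "translation_left f l"
    unfolding translation_left_def by (intro exI [of _ "\<bar>N\<bar> + 1"]) auto
qed

lemma translation_right_iff: "translation_right f r \<longleftrightarrow> (\<exists>N. \<forall>t\<ge>N. f t = t + of_int r)"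
proof
  assume "translation_right f r"
  then obtain M where "\<And>t. t > M \<Longrightarrow> f t = t + of_int r" by (auto simp: translation_right_def)
  then show "\<exists>N. \<forall>t\<ge>N. f t = t + of_int r" by (intro exI [of _ "M + 1"]) auto
next
  assume "\<exists>N. \<forall>t\<ge>N. f t = t + of_int r"
  then obtain N where "\<And>t. t \<ge> N \<Longrightarrow> f t = t + of_int r" by blast
  then show "translation_right f r"
    unfolding translation_right_def by (intro exI [of _ "\<bar>N\<bar> + 1"]) auto
qed

lemma translation_left_unique:
  assumes "translation_left f l" "translation_left f l'" shows "l = l'"
proof -
  obtain N N' where "\<forall>t\<le>N. f t = t + of_int l" "\<forall>t\<le>N'. f t = t + of_int l'"
    using assms by (auto simp: translation_left_iff)
  then have "f (min N N') = min N N' + of_int l" "f (min N N') = min N N' + of_int l'"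
    by (blast intro: min.cobounded1 min.cobounded2)+
  then show ?thesis by linarith
qed

lemma translation_right_unique:
  assumes "translation_right f l" "translation_right f l'" shows "l = l'"
proof -
  obtain N N' where "\<forall>t\<ge>N. f t = t + of_int l" "\<forall>t\<ge>N'. f t = t + of_int l'"
    using assms by (auto simp: translation_right_iff)
  then have "f (max N N') = max N N' + of_int l" "f (max N N') = max N N' + of_int l'"
    by (blast intro: max.cobounded1 max.cobounded2)+
  then show ?thesis by linarith
qed

lemma thompson_ab_eqI:
  "translation_left f l \<Longrightarrow> translation_right f r \<Longrightarrow> thompson_ab f = (l, r)"
  unfolding thompson_ab_def
  by (auto intro: the_equality translation_left_unique translation_right_unique)

lemma thompson_F_I:
  assumes "f \<in> pl2" "translation_left f l" "translation_right f r"
  shows "f \<in> carrier thompson_F" "thompson_ab f = (l, r)"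
  using assms thompson_ab_eqI by (auto simp: carrier_thompson_F)

lemma thompson_F_D:
  assumes "f \<in> carrier thompson_F"
  shows "f \<in> pl2" "translation_left f (lshift f)" "translation_right f (rshift f)"
  using assms thompson_ab_eqI by (auto simp: carrier_thompson_F)

lemma translation_left_comp:
  assumes "translation_left f l" "translation_left g l'"
  shows "translation_left (f \<circ> g) (l + l')"
proof -
  obtain N N' where "\<forall>t\<le>N. f t = t + of_int l" "\<forall>t\<le>N'. g t = t + of_int l'"
    using assms by (auto simp: translation_left_iff)
  then show ?thesis
    unfolding translation_left_iff by (intro exI [of _ "min N' (N - of_int l')"]) auto
qed

lemma translation_right_comp:
  assumes "translation_right f l" "translation_right g l'"
  shows "translation_right (f \<circ> g) (l + l')"
proof -
  obtain N N' where "\<forall>t\<ge>N. f t = t + of_int l" "\<forall>t\<ge>N'. g t = t + of_int l'"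
    using assms by (auto simp: translation_right_iff)
  then show ?thesis
    unfolding translation_right_iff by (intro exI [of _ "max N' (N - of_int l')"]) auto
qed

lemma translation_left_inv:
  assumes "inj f" "translation_left f l" shows "translation_left (finv f) (- l)"
proof -
  obtain N where N: "\<forall>t\<le>N. f t = t + of_int l"
    using assms by (auto simp: translation_left_iff)
  have "finv f t = t + of_int (- l)" if "t \<le> N + of_int l" for t
    using N that by (intro inv_f_eq [OF assms(1)]) auto
  then show ?thesis unfolding translation_left_iff by blast
qed

lemma translation_right_inv:
  assumes "inj f" "translation_right f l" shows "translation_right (finv f) (- l)"
proof -
  obtain N where N: "\<forall>t\<ge>N. f t = t + of_int l"
    using assms by (auto simp: translation_right_iff)
  have "finv f t = t + of_int (- l)" if "t \<ge> N + of_int l" for t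
    using N that by (intro inv_f_eq [OF assms(1)]) auto
  then show ?thesis unfolding translation_right_iff by blast
qed

lemma thompson_F_comp:
  assumes "f \<in> carrier thompson_F" "g \<in> carrier thompson_F"
  shows "f \<circ> g \<in> carrier thompson_F"
    "thompson_ab (f \<circ> g) = (lshift f + lshift g, rshift f + rshift g)"
  using thompson_F_I [OF pl2_comp translation_left_comp translation_right_comp]
    thompson_F_D [OF assms(1)] thompson_F_D [OF assms(2)] by blast+

lemma thompson_F_inv:
  assumes "f \<in> carrier thompson_F"
  shows "finv f \<in> carrier thompson_F" "thompson_ab (finv f) = (- lshift f, - rshift f)"
  using thompson_F_I [OF pl2_inv translation_left_inv translation_right_inv]
    thompson_F_D [OF assms] pl2_inj by blast+

section \<open>Elements that are affine between consecutive integers\<close>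

abbreviation affine_piece :: "(real \<Rightarrow> real) \<Rightarrow> int \<Rightarrow> bool" where
  "affine_piece f i \<equiv> \<exists>k::int. \<exists>c\<in>dyadic.
     \<forall>t. of_int i \<le> t \<longrightarrow> t \<le> of_int i + 1 \<longrightarrow> f t = 2 powi k * t + c"

text \<open>Adjacent pieces share the value of \<open>f\<close> at the common integer, so
  monotonicity passes from one unit interval to the next; unboundedness at both ends then gives
  surjectivity.\<close>

lemma pl2_int_pieces:
  assumes pieces: "\<And>i::int. affine_piece f i"
    and unbounded: "\<And>z. \<exists>m::int. f (of_int m) \<le> z" "\<And>z. \<exists>n::int. z < f (of_int n)"
  shows "f \<in> pl2"
proof -
  \<comment> \<open>Induction on a bound for the number of integers crossed: \<open>x\<close> is
    moved to the next integer \<open>a\<close>.\<close>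
  have less: "\<lfloor>y\<rfloor> - \<lfloor>x\<rfloor> \<le> int n \<Longrightarrow> x < y \<Longrightarrow> f x < f y" for n x y
  proof (induction n arbitrary: x)
    case 0
    obtain k c where kc: "\<And>t. of_int \<lfloor>x\<rfloor> \<le> t \<Longrightarrow> t \<le> of_int \<lfloor>x\<rfloor> + 1 \<Longrightarrow> f t = 2 powi k * t + c"
      using pieces [of "\<lfloor>x\<rfloor>"] by blast
    have "f x = 2 powi k * x + c" "f y = 2 powi k * y + c"
      using 0 by (intro kc; linarith)+
    then show ?case using 0 by simp
  next
    case (Suc n)
    obtain k c where kc: "\<And>t. of_int \<lfloor>x\<rfloor> \<le> t \<Longrightarrow> t \<le> of_int \<lfloor>x\<rfloor> + 1 \<Longrightarrow> f t = 2 powi k * t + c"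
      using pieces [of "\<lfloor>x\<rfloor>"] by blast
    define a where "a = of_int \<lfloor>x\<rfloor> + (1::real)"
    have fx: "f x = 2 powi k * x + c" by (intro kc; linarith)
    show ?case
    proof (cases "y \<le> a")
      case True
      then have "f y = 2 powi k * y + c" using Suc.prems by (intro kc; simp add: a_def) linarith
      then show ?thesis using fx Suc.prems by simp
    next
      case False
      have "f a = 2 powi k * a + c" by (intro kc; simp add: a_def)
      moreover have "x < a" by (simp add: a_def)
      ultimately have "f x < f a" using fx by simp
      moreover have "f a < f y" using Suc.prems False by (intro Suc.IH) (auto simp: a_def)
      ultimately show ?thesis by simp
    qed
  qed
  have sm: "strict_mono f"
  proof (rule strict_monoI)
    fix x y :: real assume "x < y"
    then show "f x < f y" using less [of y x "nat (\<lfloor>y\<rfloor> - \<lfloor>x\<rfloor>)"] by simp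
  qed
  have "\<exists>t. f t = z" for z
  proof -
    obtain m n where m: "f (of_int m) \<le> z" and n: "z < f (of_int n)" using unbounded by meson
    then have "m < n" using sm by (metis of_int_less_iff order_le_less_trans strict_mono_less)
    \<comment> \<open>The first integer from \<open>m\<close> on whose value exceeds
      \<open>z\<close>. As \<open>d\<close> is not 0, the preceding integer starts the unit interval
      on which \<open>z\<close> is attained.\<close>
    define d where "d = (LEAST d::nat. z < f (of_int (m + int d)))"
    have ex: "z < f (of_int (m + int (nat (n - m))))" using n \<open>m < n\<close> by simp
    have d: "z < f (of_int (m + int d))" unfolding d_def by (rule LeastI) (rule ex)
    have "d \<noteq> 0" using d m by (intro notI) simp
    then obtain d' where d': "d = Suc d'" using not0_implies_Suc by blast
    have d2: "f (of_int (m + int d')) \<le> z"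
      using not_less_Least [of d' "\<lambda>d. z < f (of_int (m + int d))"] d' unfolding d_def by simp
    define i where "i = m + int d'"
    have i: "f (of_int i) \<le> z" "z < f (of_int i + 1)"
      using d d2 by (simp_all add: i_def d' algebra_simps)
    obtain k c where kc: "\<And>t. of_int i \<le> t \<Longrightarrow> t \<le> of_int i + 1 \<Longrightarrow> f t = 2 powi k * t + c"
      using pieces [of i] by blast
    let ?t = "(z - c) / 2 powi k"
    have "f (of_int i) = 2 powi k * of_int i + c" "f (of_int i + 1) = 2 powi k * (of_int i + 1) + c"
      by (intro kc; simp)+
    then have "2 powi k * of_int i \<le> z - c" "z - c \<le> 2 powi k * (of_int i + 1)"
      using i by linarith+
    then have "of_int i \<le> ?t" "?t \<le> of_int i + 1"
      by (simp_all add: pos_le_divide_eq pos_divide_le_eq mult.commute)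
    then have "f ?t = 2 powi k * ?t + c" by (rule kc)
    then show ?thesis by auto
  qed
  then have "surj f" by (metis surjI)
  moreover have "locally_finite_set \<int>"
  proof -
    have "\<int> \<inter> {a..b} = {x \<in> \<int>. a \<le> x \<and> x \<le> b}" for a b :: real by auto
    then show ?thesis by (simp add: locally_finite_set_def finite_int_segment)
  qed
  moreover have "(\<int> :: real set) \<subseteq> dyadic" by (auto elim!: Ints_cases)
  moreover have "f ` \<int> \<subseteq> dyadic"
  proof
    fix z assume "z \<in> f ` \<int>"
    then obtain i where i: "z = f (of_int i)" by (auto elim!: Ints_cases)
    obtain k c where "c \<in> dyadic" "\<And>t. of_int i \<le> t \<Longrightarrow> t \<le> of_int i + 1 \<Longrightarrow> f t = 2 powi k * t + c"
      using pieces [of i] by blast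
    then show "z \<in> dyadic" using i by auto
  qed
  moreover have "\<exists>k c. c \<in> dyadic \<and> affine_near f (2 powi k) c x" if x: "x \<notin> \<int>" for x
  proof -
    obtain k c where kc: "c \<in> dyadic"
      "\<And>t. of_int \<lfloor>x\<rfloor> \<le> t \<Longrightarrow> t \<le> of_int \<lfloor>x\<rfloor> + 1 \<Longrightarrow> f t = 2 powi k * t + c"
      using pieces [of "\<lfloor>x\<rfloor>"] by blast
    have "of_int \<lfloor>x\<rfloor> \<noteq> x" using x by (metis Ints_of_int)
    then have "x \<in> {of_int \<lfloor>x\<rfloor><..<of_int \<lfloor>x\<rfloor> + 1}" using floor_correct [of x]
      by (auto simp: less_le)
    then have "\<forall>\<^sub>F y in nhds x. y \<in> {of_int \<lfloor>x\<rfloor><..<of_int \<lfloor>x\<rfloor> + 1}"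
      using eventually_nhds_in_open [OF open_greaterThanLessThan] by blast
    then have "affine_near f (2 powi k) c x"
      unfolding affine_near_def by eventually_elim (auto intro: kc)
    then show ?thesis using kc(1) by blast
  qed
  ultimately show ?thesis using sm unfolding pl2_def by blast
qed

lemma thompson_F_int_pieces:
  assumes pieces: "\<And>i::int. affine_piece f i"
    and "translation_left f l" "translation_right f r"
  shows "f \<in> carrier thompson_F" "thompson_ab f = (l, r)"
proof -
  obtain N where N: "\<forall>t\<le>N. f t = t + of_int l" using assms by (auto simp: translation_left_iff)
  obtain M where M: "\<forall>t\<ge>M. f t = t + of_int r" using assms by (auto simp: translation_right_iff)
  have "f \<in> pl2"
  proof (rule pl2_int_pieces [OF pieces])
    fix z :: real
    let ?m = "min \<lfloor>N\<rfloor> (\<lfloor>z\<rfloor> - l)" and ?n = "max \<lceil>M\<rceil> (\<lceil>z\<rceil> + 1 - r)"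
    have 1: "of_int ?m \<le> N" "of_int ?m + of_int l \<le> (z::real)" by linarith+
    have 2: "of_int ?n \<ge> M" "of_int ?n + of_int r > (z::real)" by linarith+
    show "\<exists>m. f (of_int m) \<le> z" using N 1 by metis
    show "\<exists>n. z < f (of_int n)" using M 2 by metis
  qed
  then show "f \<in> carrier thompson_F" "thompson_ab f = (l, r)"
    using thompson_F_I assms by blast+
qed

text \<open>Identity up to \<open>i\<close>, slope 1/2 from \<open>i\<close> to
  \<open>i + 2\<close>, translation by -1 beyond. These maps satisfy the relations of the usual
  infinite generating family of Thompson's group, here indexed by all integers.\<close>

definition contract :: "int \<Rightarrow> real \<Rightarrow> real" where
  "contract i t = min t (max ((t + of_int i) / 2) (t - 1))"

lemma half_of_int_dyadic [simp]: "of_int i / 2 \<in> dyadic"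
  using dyadic_mult [OF dyadic_powi [of "-1"] dyadic_of_int [of i]]
  by (simp add: power_int_minus field_simps)

lemma contract_in: "contract i \<in> carrier thompson_F" and ab_contract: "thompson_ab (contract i) = (0, -1)"
proof -
  have *: "affine_piece (contract i) j" for j
  proof -
    consider "j < i" | "i \<le> j" "j < i + 2" | "j \<ge> i + 2" by linarith
    then show ?thesis
    proof cases
      case 1
      then have "of_int j + 1 \<le> (of_int i :: real)" by linarith
      then show ?thesis
        by (intro exI [of _ 0] bexI [of _ 0]) (auto simp: contract_def min_def max_def)
    next
      case 2
      then have "of_int i \<le> (of_int j :: real)" "of_int j + 1 \<le> (of_int i + 2 :: real)" by linarith+
      then show ?thesis
        by (intro exI [of _ "-1"] bexI [of _ "of_int i / 2"])
          (auto simp: contract_def min_def max_def power_int_minus field_simps)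
    next
      case 3
      then have "of_int i + 2 \<le> (of_int j :: real)" by linarith
      then show ?thesis
        by (intro exI [of _ 0] bexI [of _ "-1"])
          (auto simp: contract_def min_def max_def intro: dyadic_of_int [of "-1", simplified])
    qed
  qed
  have "translation_left (contract i) 0"
    unfolding translation_left_iff by (intro exI [of _ "of_int i"]) (auto simp: contract_def)
  moreover have "translation_right (contract i) (-1)"
    unfolding translation_right_iff
      by (intro exI [of _ "of_int i + 2"]) (auto simp: contract_def min_def max_def)
  ultimately show "contract i \<in> carrier thompson_F" "thompson_ab (contract i) = (0, -1)"
    using thompson_F_int_pieces [OF *] by blast+
qed

definition unit_shift :: "real \<Rightarrow> real" where "unit_shift t = t + 1"

lemma unit_shift_in: "unit_shift \<in> carrier thompson_F" and ab_unit_shift: "thompson_ab unit_shift = (1, 1)"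
proof -
  have *: "affine_piece unit_shift i" for i :: int
    by (intro exI [of _ 0] bexI [of _ 1]) (auto simp: unit_shift_def)
  have "translation_left unit_shift 1" "translation_right unit_shift 1"
    by (simp_all add: translation_left_iff translation_right_iff unit_shift_def)
  then show "unit_shift \<in> carrier thompson_F" "thompson_ab unit_shift = (1, 1)"
    using thompson_F_int_pieces [OF *] by blast+
qed

text \<open>Fixes 0 and leaves it on each side with slope 2 or 1/2 until the prescribed displacement
  is reached; a side with displacement 0 is fixed pointwise.\<close>

definition end_shifts :: "int \<Rightarrow> int \<Rightarrow> real \<Rightarrow> real" where
  "end_shifts l r t =
    (if t \<ge> 0 then (if r > 0 then min (2 * t) (t + of_int r) else max (t / 2) (t + of_int r))
     else (if l > 0 then min (t / 2) (t + of_int l) else max (2 * t) (t + of_int l)))"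

lemma end_shifts_in: "end_shifts l r \<in> carrier thompson_F"
  and ab_end_shifts: "thompson_ab (end_shifts l r) = (l, r)"
proof -
  have *: "affine_piece (end_shifts l r) j" for j :: int
  proof -
    \<comment> \<open>The slope changes away from 0 are at \<open>r\<close> or
      \<open>- 2 * r\<close> on the right and at \<open>- 2 * l\<close> or \<open>l\<close> on the
      left. All are integers, so each unit interval meets one formula only.\<close>
    consider
        (a) "j \<ge> 0" "r > 0" "j < r" | (b) "j \<ge> 0" "r \<le> 0" "j < -2 * r"
      | (c) "j < 0" "l > 0" "-2 * l \<le> j" | (d) "j < 0" "l \<le> 0" "l \<le> j"
      | (e) "j \<ge> 0" "r > 0 \<and> j \<ge> r \<or> r \<le> 0 \<and> j \<ge> -2 * r"
      | (f) "j < 0" "l > 0 \<and> j < -2 * l \<or> l \<le> 0 \<and> j < l"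
      by linarith
    then show ?thesis
    proof cases
      case a
      then have "0 \<le> (of_int j :: real)" "of_int j + 1 \<le> (of_int r :: real)" by linarith+
      then show ?thesis using a
        by (intro exI [of _ 1] bexI [of _ 0]) (auto simp: end_shifts_def min_def max_def)
    next
      case b
      then have "0 \<le> (of_int j :: real)" "of_int j + 1 \<le> (-2 * of_int r :: real)" by linarith+
      then show ?thesis using b
        by (intro exI [of _ "-1"] bexI [of _ 0]) (auto simp: end_shifts_def min_def max_def power_int_minus)
    next
      case c
      then have "of_int j + 1 \<le> (0 :: real)" "-2 * of_int l \<le> (of_int j :: real)" by linarith+
      then show ?thesis using c
        by (intro exI [of _ "-1"] bexI [of _ 0]) (auto simp: end_shifts_def min_def max_def power_int_minus)
    next
      case d
      then have "of_int j + 1 \<le> (0 :: real)" "of_int l \<le> (of_int j :: real)" by linarith+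
      then show ?thesis using d
        by (intro exI [of _ 1] bexI [of _ 0]) (auto simp: end_shifts_def min_def max_def)
    next
      case e
      then have "0 \<le> (of_int j :: real)" "0 < r \<and> of_int j \<ge> (of_int r :: real) \<or> r \<le> 0 \<and> of_int j \<ge> (-2 * of_int r :: real)"
        by linarith+
      then show ?thesis
        by (intro exI [of _ 0] bexI [of _ "of_int r"]) (auto simp: end_shifts_def min_def max_def)
    next
      case f
      then have "of_int j + 1 \<le> (0 :: real)" "0 < l \<and> of_int j + 1 \<le> (-2 * of_int l :: real) \<or> l \<le> 0 \<and> of_int j + 1 \<le> (of_int l :: real)"
        by linarith+
      then show ?thesis
        by (intro exI [of _ 0] bexI [of _ "of_int l"]) (auto simp: end_shifts_def min_def max_def)
    qed
  qed
  have "translation_left (end_shifts l r) l"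
    unfolding translation_left_iff
    by (intro exI [of _ "-2 * \<bar>of_int l\<bar> - 1"]) (auto simp: end_shifts_def min_def max_def abs_if)
  moreover have "translation_right (end_shifts l r) r"
    unfolding translation_right_iff
    by (intro exI [of _ "2 * \<bar>of_int r\<bar>"]) (auto simp: end_shifts_def min_def max_def abs_if)
  ultimately show "end_shifts l r \<in> carrier thompson_F" "thompson_ab (end_shifts l r) = (l, r)"
    using thompson_F_int_pieces [OF *] by blast+
qed

lemma end_shifts_fixed: "l \<noteq> 0 \<Longrightarrow> r \<noteq> 0 \<Longrightarrow> end_shifts l r t = t \<longleftrightarrow> t = 0"
  by (auto simp: end_shifts_def min_def max_def split: if_splits)

lemma group_thompson_F: "group thompson_F"
proof (rule groupI)
  have "translation_left id 0" "translation_right id 0"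
    by (auto simp: translation_left_iff translation_right_iff)
  then show "\<one>\<^bsub>thompson_F\<^esub> \<in> carrier thompson_F"
    using thompson_F_comp(1) [OF thompson_F_inv(1) unit_shift_in, OF unit_shift_in]
      pl2_inj [OF thompson_F_D(1) [OF unit_shift_in]] by simp
  fix f assume f: "f \<in> carrier thompson_F"
  show "\<exists>g\<in>carrier thompson_F. g \<otimes>\<^bsub>thompson_F\<^esub> f = \<one>\<^bsub>thompson_F\<^esub>"
    using thompson_F_inv(1) [OF f] pl2_inj [OF thompson_F_D(1) [OF f]]
      by (intro bexI [of _ "finv f"]) simp_all
qed (auto simp: thompson_F_comp comp_assoc)

lemma m_inv_thompson_F:
  assumes "f \<in> carrier thompson_F" shows "inv\<^bsub>thompson_F\<^esub> f = finv f"
  using thompson_F_inv(1) [OF assms] pl2_inj [OF thompson_F_D(1) [OF assms]] assms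
  by (intro group.inv_equality [OF group_thompson_F]) simp_all

lemma ab_id: "thompson_ab id = (0, 0)"
  by (intro thompson_ab_eqI) (auto simp: translation_left_iff translation_right_iff)

section \<open>Generation by the contractions and the unit translation\<close>

lemma expand_inv: "finv (contract j) t = max t (min (2 * t - of_int j) (t + 1))"
  using pl2_inj [OF thompson_F_D(1) [OF contract_in]]
  by (rule inv_f_eq) (auto simp: contract_def min_def max_def field_simps)

lemma mult_pow2_le_iff: "(x::real) * 2 ^ n \<le> y * 2 ^ n \<longleftrightarrow> x \<le> y"
  by (rule mult_le_cancel_right_pos) simp

text \<open>The affine germ is locally constant, hence constant on the connected open interval; the
  set where the resulting formula holds is closed, which adds the end points.\<close>

lemma pl2_affine_between:
  assumes f: "strict_mono f" "surj f"
    and aff: "\<And>x. a < x \<Longrightarrow> x < b \<Longrightarrow> \<exists>k c. c \<in> dyadic \<and> affine_near f (2 powi k) c x"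
    and "a < b"
  shows "\<exists>k::int. \<exists>c\<in>dyadic. \<forall>t\<in>{a..b}. f t = 2 powi k * t + c"
proof -
  define x0 where "x0 = (a + b) / 2"
  have x0: "x0 \<in> {a<..<b}" using \<open>a < b\<close> by (simp add: x0_def)
  then obtain k c where kc: "c \<in> dyadic" "affine_near f (2 powi k) c x0" using aff [of x0] by auto
  define h where "h y = {(m, c). affine_near f m c y}" for y
  have h_eq: "h y = {(m, c)}" if "affine_near f m c y" for m c y
    using that affine_near_unique unfolding h_def by auto
  have "\<forall>x\<in>{a<..<b}. \<forall>\<^sub>F y in at x within {a<..<b}. h x = h y"
  proof
    fix x assume "x \<in> {a<..<b}"
    then obtain m d where md: "affine_near f m d x" using aff by fastforce
    have "\<forall>\<^sub>F y in nhds x. h x = h y"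
      using affine_near_eventually [OF md] by eventually_elim (simp add: h_eq [OF md] h_eq)
    then show "\<forall>\<^sub>F y in at x within {a<..<b}. h x = h y"
      by (simp add: eventually_at_filter eventually_mono)
  qed
  then have "h x0 = h y" if "y \<in> {a<..<b}" for y
    using connected_local_const [of "{a<..<b}" x0 y h] x0 that by auto
  then have "affine_near f (2 powi k) c y" if "y \<in> {a<..<b}" for y
    using that h_eq [OF kc(2)] unfolding h_def by blast
  then have "{a<..<b} \<subseteq> {t. f t = 2 powi k * t + c}"
    unfolding affine_near_def using eventually_nhds_x_imp_x by blast
  moreover have "closed {t. f t = 2 powi k * t + c}"
    by (intro closed_Collect_eq continuous_strict_mono_surj f continuous_intros)
  ultimately have "closure {a<..<b} \<subseteq> {t. f t = 2 powi k * t + c}" by (rule closure_minimal)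
  then show ?thesis using \<open>a < b\<close> kc(1) by (auto simp: closure_greaterThanLessThan subset_iff)
qed

text \<open>Each standard dyadic interval of length \<open>1 / 2 ^ n\<close> goes affinely onto a
  standard dyadic interval of length \<open>1 / 2 ^ m\<close>, with \<open>m\<close> depending on
  the interval. As \<open>m\<close> is natural, no image is longer than 1.\<close>

definition subdivided :: "nat \<Rightarrow> (real \<Rightarrow> real) \<Rightarrow> bool" where
  "subdivided n f \<longleftrightarrow> (\<forall>i::int. \<exists>m::nat. \<exists>e::int. \<forall>t.
     of_int i \<le> t * 2 ^ n \<longrightarrow> t * 2 ^ n \<le> of_int i + 1 \<longrightarrow> f t * 2 ^ m = t * 2 ^ n + of_int e)"

lemma thompson_F_translation_bound:
  assumes "f \<in> carrier thompson_F"
  obtains M :: nat where "\<And>t. t \<le> - real M \<Longrightarrow> f t = t + of_int (lshift f)"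
    "\<And>t. t \<ge> real M \<Longrightarrow> f t = t + of_int (rshift f)"
proof -
  obtain N where N: "\<forall>t\<le>N. f t = t + of_int (lshift f)"
    using thompson_F_D(2) [OF assms] by (auto simp: translation_left_iff)
  obtain N' where N': "\<forall>t\<ge>N'. f t = t + of_int (rshift f)"
    using thompson_F_D(3) [OF assms] by (auto simp: translation_right_iff)
  obtain M :: nat where "max (- N) N' \<le> real M" using real_arch_simple by blast
  then show thesis using N N' by (intro that [of M]) auto
qed

text \<open>Within a bounded range, the finitely many breakpoints, slopes and intercepts are all
  resolved at a fine enough level; beyond it \<open>f\<close> is an integer translation, for which
  every level works.\<close>

lemma subdivided_exists:
  assumes f: "f \<in> carrier thompson_F" shows "\<exists>n. subdivided n f"
proof -
  obtain M where M: "\<And>t. t \<le> - real M \<Longrightarrow> f t = t + of_int (lshift f)"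
    "\<And>t. t \<ge> real M \<Longrightarrow> f t = t + of_int (rshift f)"
    using thompson_F_translation_bound [OF f] by blast
  have sm: "strict_mono f" "surj f" using thompson_F_D(1) [OF f] pl2_strict_mono pl2_surj by auto
  obtain B where B: "B \<subseteq> dyadic" "locally_finite_set B"
    and aff: "\<And>x. x \<notin> B \<Longrightarrow> \<exists>k c. c \<in> dyadic \<and> affine_near f (2 powi k) c x"
    using thompson_F_D(1) [OF f] by (auto simp: pl2_def)
  have ev: "\<forall>\<^sub>F n in sequentially. b * 2 ^ n \<in> \<int>" if "b \<in> dyadic" for b
    using that dyadic_scaled_Ints_mono unfolding dyadic_iff eventually_sequentially by blast
  have "\<forall>\<^sub>F n in sequentially. \<forall>b\<in>B \<inter> {- real M..real M}. b * 2 ^ n \<in> \<int>"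
    using B ev by (intro eventually_ball_finite) (auto simp: locally_finite_set_def)
  then obtain n0 where n0: "\<And>b. b \<in> B \<Longrightarrow> - real M \<le> b \<Longrightarrow> b \<le> real M \<Longrightarrow> b * 2 ^ n0 \<in> \<int>"
    using eventually_happens by force
  \<comment> \<open>The grid stays at level \<open>n0\<close> while \<open>n\<close> grows. This
    leaves finitely many indices \<open>i\<close> in the bounded range, so one \<open>n\<close> can
    be chosen for all of them.\<close>
  define P where "P i n \<longleftrightarrow> (\<exists>m::nat. \<exists>e::int. \<forall>t.
    of_int i \<le> t * 2 ^ n0 \<longrightarrow> t * 2 ^ n0 \<le> of_int i + 1 \<longrightarrow> f t * 2 ^ m = t * 2 ^ n + of_int e)"
    for i :: int and n :: nat
  have P_out: "P i n" if "i < - int M * 2 ^ n0 \<or> i \<ge> int M * 2 ^ n0" for i n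
    using that
  proof
    assume "i < - int M * 2 ^ n0"
    then have "i + 1 \<le> - int M * 2 ^ n0" by simp
    then have "of_int (i + 1) \<le> (of_int (- int M * 2 ^ n0) :: real)" by (simp only: of_int_le_iff)
    then have le: "of_int i + 1 \<le> (- real M) * 2 ^ n0" by simp
    have "t \<le> - real M" if "t * 2 ^ n0 \<le> of_int i + 1" for t
      using order_trans [OF that le] by (simp only: mult_pow2_le_iff)
    then show "P i n" using M(1) unfolding P_def
      by (intro exI [of _ n] exI [of _ "lshift f * 2 ^ n"]) (simp add: ring_distribs)
  next
    assume "i \<ge> int M * 2 ^ n0"
    then have "of_int i \<ge> (of_int (int M * 2 ^ n0) :: real)" by (simp only: of_int_le_iff)
    then have le: "real M * 2 ^ n0 \<le> of_int i" by simp
    have "t \<ge> real M" if "of_int i \<le> t * 2 ^ n0" for t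
      using order_trans [OF le that] by (simp only: mult_pow2_le_iff)
    then show "P i n" using M(2) unfolding P_def
      by (intro exI [of _ n] exI [of _ "rshift f * 2 ^ n"]) (simp add: ring_distribs)
  qed
  have P_in: "\<forall>\<^sub>F n in sequentially. P i n" if i: "i \<in> {- int M * 2 ^ n0..<int M * 2 ^ n0}" for i
  proof -
    let ?a = "of_int i / (2 ^ n0 :: real)" and ?b = "(of_int i + 1) / (2 ^ n0 :: real)"
    have "of_int (- int M * 2 ^ n0) \<le> (of_int i :: real)" "of_int (i + 1) \<le> (of_int (int M * 2 ^ n0) :: real)"
      using i by (simp_all only: of_int_le_iff) auto
    then have ab: "- real M \<le> ?a" "?b \<le> real M"
      by (simp_all add: pos_le_divide_eq pos_divide_le_eq)
    have "x \<notin> B" if x: "?a < x" "x < ?b" for x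
    proof
      assume "x \<in> B"
      then obtain z where z: "x * 2 ^ n0 = of_int z" using n0 [of x] x ab by (auto elim: Ints_cases)
      have "of_int i < x * 2 ^ n0" "x * 2 ^ n0 < of_int i + 1"
        using x by (simp_all add: pos_less_divide_eq pos_divide_less_eq)
      then have "of_int i < (of_int z :: real)" "of_int z < (of_int (i + 1) :: real)"
        unfolding z by simp_all
      then show False unfolding of_int_less_iff by linarith
    qed
    then obtain k :: int and c where kc: "c \<in> dyadic" "\<forall>t\<in>{?a..?b}. f t = 2 powi k * t + c"
      using pl2_affine_between [OF sm, of ?a ?b] aff
        by (metis divide_strict_right_mono less_add_one zero_less_numeral zero_less_power)
    obtain s where s: "c * 2 ^ s \<in> \<int>" using kc(1) by (auto simp: dyadic_iff)
    have "P i n" if n: "n \<ge> s + nat \<bar>k\<bar>" for n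
    proof -
      \<comment> \<open>This exponent makes \<open>2 powi k * 2 ^ m\<close> equal to
        \<open>2 ^ n\<close>; the bound on \<open>n\<close> makes it at least \<open>s\<close>, so
        that \<open>c * 2 ^ m\<close> is an integer.\<close>
      define m where "m = nat (int n - k)"
      have "s \<le> m" "int m = int n - k" using n by (auto simp: m_def)
      then obtain e where e: "c * 2 ^ m = of_int e"
        using dyadic_scaled_Ints_mono [OF s] by (auto elim: Ints_cases)
      have "(2::real) powi k * 2 ^ m = 2 powi (k + int m)" by (simp add: power_int_add)
      also have "\<dots> = 2 ^ n" using \<open>int m = int n - k\<close> by (simp add: power_int_def)
      finally have 2: "(2::real) powi k * 2 ^ m = 2 ^ n" .
      have "f t * 2 ^ m = t * 2 ^ n + of_int e"
        if "of_int i \<le> t * 2 ^ n0" "t * 2 ^ n0 \<le> of_int i + 1" for t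
      proof -
        have "f t = 2 powi k * t + c"
          using that kc(2) by (simp add: pos_le_divide_eq pos_divide_le_eq)
        then have "f t * 2 ^ m = (2 powi k * 2 ^ m) * t + c * 2 ^ m" by (simp add: algebra_simps)
        then show ?thesis unfolding 2 e by simp
      qed
      then show ?thesis unfolding P_def by blast
    qed
    then show ?thesis unfolding eventually_sequentially by blast
  qed
  have "\<forall>\<^sub>F n in sequentially. \<forall>i\<in>{- int M * 2 ^ n0..<int M * 2 ^ n0}. P i n"
    using P_in by (intro eventually_ball_finite) auto
  then have "\<forall>\<^sub>F n in sequentially. n \<ge> n0 \<and> (\<forall>i. P i n)"
    using eventually_ge_at_top [of n0]
    by eventually_elim (metis P_out atLeastLessThan_iff linorder_not_le)
  then obtain n where n: "n \<ge> n0" "\<And>i. P i n" using eventually_happens by force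
  have "subdivided n f" unfolding subdivided_def
  proof
    fix i :: int
    define d where "d = n - n0"
    \<comment> \<open>The index of the interval of the coarser level \<open>n0\<close> that contains
      interval \<open>i\<close> of level \<open>n\<close>.\<close>
    define i0 where "i0 = i div 2 ^ d"
    have nd: "(2::real) ^ n = 2 ^ n0 * 2 ^ d" using n(1) by (simp add: d_def flip: power_add)
    have "i0 * 2 ^ d + i mod 2 ^ d = i" unfolding i0_def by (rule div_mult_mod_eq)
    moreover have "0 \<le> i mod 2 ^ d" "i mod 2 ^ d < 2 ^ d" by simp_all
    ultimately have "i0 * 2 ^ d \<le> i" "i + 1 \<le> (i0 + 1) * 2 ^ d"
      unfolding ring_distribs by linarith+
    then have "of_int (i0 * 2 ^ d) \<le> (of_int i :: real)" "of_int (i + 1) \<le> (of_int ((i0 + 1) * 2 ^ d) :: real)"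
      by (simp_all only: of_int_le_iff)
    then have i0: "of_int i0 * 2 ^ d \<le> (of_int i :: real)" "of_int i + 1 \<le> (of_int i0 + 1) * (2 ^ d :: real)"
      by simp_all
    have "of_int i0 \<le> t * 2 ^ n0 \<and> t * 2 ^ n0 \<le> of_int i0 + 1"
      if "of_int i \<le> t * 2 ^ n" "t * 2 ^ n \<le> of_int i + 1" for t :: real
    proof -
      have "of_int i0 * 2 ^ d \<le> (t * 2 ^ n0) * 2 ^ d" "(t * 2 ^ n0) * 2 ^ d \<le> (of_int i0 + 1) * 2 ^ d"
        using order_trans [OF i0(1) that(1)] order_trans [OF that(2) i0(2)]
        unfolding nd mult.assoc by blast+
      then show ?thesis by (simp only: mult_pow2_le_iff)
    qed
    then show "\<exists>m::nat. \<exists>e::int. \<forall>t. of_int i \<le> t * 2 ^ n \<longrightarrow> t * 2 ^ n \<le> of_int i + 1 \<longrightarrow>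
        f t * 2 ^ m = t * 2 ^ n + of_int e"
      using n(2) [of i0] unfolding P_def by metis
  qed
  then show ?thesis ..
qed

section \<open>Factorization into generators\<close>

abbreviation thompson_gens :: "(real \<Rightarrow> real) set" where
  "thompson_gens \<equiv> insert unit_shift (range contract)"

lemma thompson_gens_sub: "thompson_gens \<subseteq> carrier thompson_F"
  using contract_in unit_shift_in by auto

lemma contract_generated: "contract i \<in> generate thompson_F thompson_gens"
  by (intro generate.incl) auto

lemma generate_comp:
  "f \<in> generate thompson_F A \<Longrightarrow> g \<in> generate thompson_F A \<Longrightarrow> f \<circ> g \<in> generate thompson_F A"
  using generate.eng [of f thompson_F A g] by simp

lemma generate_finv:
  assumes "f \<in> generate thompson_F A" "A \<subseteq> carrier thompson_F"
  shows "finv f \<in> generate thompson_F A"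
  using group.generate_m_inv_closed [OF group_thompson_F assms(2,1)]
    group.generate_in_carrier [OF group_thompson_F assms(2,1)] m_inv_thompson_F by simp

lemma generate_cancel_right:
  assumes "f \<circ> g \<in> generate thompson_F A" "g \<in> generate thompson_F A"
    "A \<subseteq> carrier thompson_F"
  shows "f \<in> generate thompson_F A"
proof -
  have "g \<in> carrier thompson_F" using group.generate_in_carrier [OF group_thompson_F] assms by blast
  then have "(f \<circ> g) \<circ> finv g = f"
    using pl2_surj [OF thompson_F_D(1)] by (auto simp: fun_eq_iff surj_f_inv_f)
  then show ?thesis using generate_comp [OF assms(1) generate_finv [OF assms(2,3)]] by simp
qed

text \<open>Halves the interval from \<open>a\<close> to \<open>a + 2 * k\<close>, fixing everything
  to its left and translating everything to its right by \<open>- k\<close>.\<close>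

definition contract_interval :: "int \<Rightarrow> nat \<Rightarrow> real \<Rightarrow> real" where
  "contract_interval a k t = min t (max ((t + of_int a) / 2) (t - real k))"

lemma contract_interval_generated: "contract_interval a k \<in> generate thompson_F thompson_gens"
proof (induction k)
  case 0
  have "contract_interval a 0 = id" by (auto simp: contract_interval_def fun_eq_iff)
  then show ?case using generate.one [of thompson_F thompson_gens] by (simp only: one_thompson_F)
next
  case (Suc k)
  \<comment> \<open>The right factor halves the next interval of length 2 and fixes all that lies to
    its left; the left factor translates the image of that interval by \<open>- k\<close>.\<close>
  have "contract_interval a (Suc k) = contract_interval a k \<circ> contract (a + 2 * int k)"
    by (auto simp: contract_interval_def contract_def fun_eq_iff min_def max_def field_simps)
  then show ?case using generate_comp [OF Suc contract_generated] by (simp only:)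
qed

text \<open>Precomposing with a halving map \<open>g\<close> carries intervals of level
  \<open>n\<close> to intervals of level \<open>n + 1\<close> wherever \<open>f\<close> is not yet
  known to be a translation; elsewhere only integer translations are composed.\<close>

lemma subdivided_Suc:
  assumes f: "f \<in> carrier thompson_F" and sub: "subdivided (Suc n) f"
  shows "\<exists>g\<in>generate thompson_F thompson_gens. subdivided n (f \<circ> g)"
proof -
  obtain M where M: "\<And>t. t \<le> - real M \<Longrightarrow> f t = t + of_int (lshift f)"
    "\<And>t. t \<ge> real M \<Longrightarrow> f t = t + of_int (rshift f)"
    using thompson_F_translation_bound [OF f] by blast
  \<comment> \<open>Maps the interval from \<open>- M\<close> to \<open>3 * M\<close> onto the one
    from \<open>- M\<close> to \<open>M\<close>, outside which \<open>f\<close> is a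
    translation.\<close>
  define g where "g = contract_interval (- int M) (2 * M)"
  have g: "t \<le> - real M \<Longrightarrow> g t = t" "t \<ge> 3 * real M \<Longrightarrow> g t = t - 2 * real M"
    "- real M \<le> t \<Longrightarrow> t \<le> 3 * real M \<Longrightarrow> g t = (t - real M) / 2" for t
    by (auto simp: g_def contract_interval_def min_def max_def field_simps)
  have "subdivided n (f \<circ> g)" unfolding subdivided_def
  proof
    fix i :: int
    consider (a) "i + 1 \<le> - int M * 2 ^ n" | (b) "i \<ge> 3 * int M * 2 ^ n"
      | (c) "- int M * 2 ^ n \<le> i" "i + 1 \<le> 3 * int M * 2 ^ n" by linarith
    then show "\<exists>m::nat. \<exists>e::int. \<forall>t. of_int i \<le> t * 2 ^ n \<longrightarrow> t * 2 ^ n \<le> of_int i + 1 \<longrightarrow>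
        (f \<circ> g) t * 2 ^ m = t * 2 ^ n + of_int e"
    proof cases
      case a
      then have "of_int (i + 1) \<le> (of_int (- int M * 2 ^ n) :: real)" by (simp only: of_int_le_iff)
      then have le: "of_int i + 1 \<le> (- real M) * 2 ^ n" by simp
      have "t \<le> - real M" if "t * 2 ^ n \<le> of_int i + 1" for t
        using order_trans [OF that le] by (simp only: mult_pow2_le_iff)
      then show ?thesis using M(1) g(1)
        by (intro exI [of _ n] exI [of _ "lshift f * 2 ^ n"]) (simp add: ring_distribs)
    next
      case b
      then have "of_int i \<ge> (of_int (3 * int M * 2 ^ n) :: real)" by (simp only: of_int_le_iff)
      then have le: "(3 * real M) * 2 ^ n \<le> of_int i" by simp
      have "t \<ge> 3 * real M" if "of_int i \<le> t * 2 ^ n" for t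
        using order_trans [OF le that] by (simp only: mult_pow2_le_iff)
      then have "(f \<circ> g) t = t - 2 * real M + of_int (rshift f)" if "of_int i \<le> t * 2 ^ n" for t
        using M(2) [of "t - 2 * real M"] g(2) [of t] that by fastforce
      then have "(f \<circ> g) t * 2 ^ n = t * 2 ^ n + of_int ((rshift f - 2 * int M) * 2 ^ n)"
        if "of_int i \<le> t * 2 ^ n" for t using that by (simp add: ring_distribs)
      then show ?thesis by blast
    next
      case c
      then have "of_int (- int M * 2 ^ n) \<le> (of_int i :: real)"
        "of_int (i + 1) \<le> (of_int (3 * int M * 2 ^ n) :: real)" by (simp_all only: of_int_le_iff)
      then have le: "(- real M) * 2 ^ n \<le> of_int i" "of_int i + 1 \<le> (3 * real M) * 2 ^ n"
        by simp_all
      have "- real M \<le> t \<and> t \<le> 3 * real M" if "of_int i \<le> t * 2 ^ n" "t * 2 ^ n \<le> of_int i + 1" for t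
        using order_trans [OF le(1) that(1)] order_trans [OF that(2) le(2)]
          by (simp only: mult_pow2_le_iff)
      then have gt: "g t = (t - real M) / 2" if "of_int i \<le> t * 2 ^ n" "t * 2 ^ n \<le> of_int i + 1" for t
        using that g(3) by blast
      obtain m :: nat and e :: int where me: "\<forall>t. of_int (i - int M * 2 ^ n) \<le> t * 2 ^ Suc n \<longrightarrow>
        t * 2 ^ Suc n \<le> of_int (i - int M * 2 ^ n) + 1 \<longrightarrow> f t * 2 ^ m = t * 2 ^ Suc n + of_int e"
        using sub unfolding subdivided_def by meson
      have "(f \<circ> g) t * 2 ^ m = t * 2 ^ n + of_int (e - int M * 2 ^ n)"
        if t: "of_int i \<le> t * 2 ^ n" "t * 2 ^ n \<le> of_int i + 1" for t
      proof -
        have "g t * 2 ^ Suc n = t * 2 ^ n - real M * 2 ^ n" unfolding gt [OF t]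
          by (simp add: left_diff_distrib)
        then show ?thesis using me [rule_format, of "g t"] t by simp
      qed
      then show ?thesis by blast
    qed
  qed
  then show ?thesis using contract_interval_generated unfolding g_def by blast
qed

lemma translation_generated: "(\<lambda>t. t + of_int l) \<in> generate thompson_F thompson_gens"
proof (induction l rule: int_induct [where k = 0])
  case base
  then show ?case using generate.one [of thompson_F thompson_gens] by (simp add: id_def)
next
  case (step1 i)
  have "(\<lambda>t. t + of_int (i + 1)) = unit_shift \<circ> (\<lambda>t. t + of_int i)"
    by (auto simp: unit_shift_def fun_eq_iff)
  then show ?case using generate_comp [OF generate.incl step1(2), of unit_shift] by simp
next
  case (step2 i)
  have "(\<lambda>t. t + of_int (i - 1)) \<circ> unit_shift = (\<lambda>t. t + of_int i)"
    by (auto simp: unit_shift_def fun_eq_iff)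
  then show ?case using generate_cancel_right [OF _ _ thompson_gens_sub, of "\<lambda>t. t + of_int (i - 1)" unit_shift]
      step2(2) generate.incl [of unit_shift thompson_gens thompson_F] by simp
qed

text \<open>Unit intervals go to intervals of length at most 1, so the displacement at integers
  never increases and \<open>rshift f \<le> lshift f\<close>. If the two are equal, \<open>f\<close>
  is a translation. Otherwise the inverse of a contraction is applied after \<open>f\<close>,
  raising the right translation by 1.\<close>

lemma subdivided_0_generated:
  assumes "f \<in> carrier thompson_F" "subdivided 0 f"
  shows "f \<in> generate thompson_F thompson_gens"
  using assms
proof (induction "nat (lshift f - rshift f)" arbitrary: f)
  fix f
  assume f: "f \<in> carrier thompson_F" and sub: "subdivided 0 f"
  have sm: "strict_mono f" using thompson_F_D(1) [OF f] pl2_strict_mono by auto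
  obtain M where M: "\<And>t. t \<le> - real M \<Longrightarrow> f t = t + of_int (lshift f)"
    "\<And>t. t \<ge> real M \<Longrightarrow> f t = t + of_int (rshift f)"
    using thompson_F_translation_bound [OF f] by blast
  have pc: "\<exists>m::nat. \<exists>e::int. \<forall>t. of_int i \<le> t \<longrightarrow> t \<le> of_int i + 1 \<longrightarrow> f t * 2 ^ m = t + of_int e"
    for i using sub by (simp add: subdivided_def)
  have step: "(f (of_int i + 1) - f (of_int i)) * 2 ^ m = 1"
    if "\<forall>t. of_int i \<le> t \<longrightarrow> t \<le> of_int i + 1 \<longrightarrow> f t * 2 ^ m = t + of_int e" for i m and e :: int
    using that [rule_format, of "of_int i"] that [rule_format, of "of_int i + 1"]
    by (simp add: left_diff_distrib)
  define d where "d i = f (of_int i) - of_int i" for i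
  have d_step: "d (i + 1) \<le> d i" for i
  proof -
    obtain m e where "\<forall>t. of_int i \<le> t \<longrightarrow> t \<le> of_int i + 1 \<longrightarrow> f t * 2 ^ m = t + of_int e"
      using pc by blast
    from step [OF this] have "f (of_int i + 1) - f (of_int i) = 1 / 2 ^ m"
      by (simp add: field_simps)
    then have "f (of_int i + 1) - f (of_int i) \<le> 1" by simp
    then show ?thesis by (simp add: d_def)
  qed
  have d_mono: "d j \<le> d i" if "i \<le> j" for i j
    using that by (induction rule: int_ge_induct) (auto intro: order_trans [OF d_step])
  have d_left: "d i = of_int (lshift f)" if "i \<le> - int M" for i
    using that M(1) [of "of_int i"] by (simp add: d_def)
  have d_right: "d i = of_int (rshift f)" if "i \<ge> int M" for i
    using that M(2) [of "of_int i"] by (simp add: d_def)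
  have rl: "rshift f \<le> lshift f" using d_mono [of "- int M" "int M"] d_left d_right by simp
  {
    assume "0 = nat (lshift f - rshift f)"
    then have eq: "rshift f = lshift f" using rl by simp
    have dc: "d i = of_int (lshift f)" for i
      using d_mono [of i "max i (int M)"] d_mono [of "min i (- int M)" i]
        d_left [of "min i (- int M)"] d_right [of "max i (int M)"] eq by simp
    have "f t = t + of_int (lshift f)" for t
    proof -
      obtain m e where me: "\<forall>u. of_int \<lfloor>t\<rfloor> \<le> u \<longrightarrow> u \<le> of_int \<lfloor>t\<rfloor> + 1 \<longrightarrow> f u * 2 ^ m = u + of_int e"
        using pc by blast
      have "f (of_int \<lfloor>t\<rfloor> + 1) - f (of_int \<lfloor>t\<rfloor>) = 1"
        using dc [of "\<lfloor>t\<rfloor> + 1"] dc [of "\<lfloor>t\<rfloor>"] by (simp add: d_def)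
      with step [OF me] have "(2::real) ^ m = 1" by simp
      then have "f (of_int \<lfloor>t\<rfloor>) = of_int \<lfloor>t\<rfloor> + of_int e" "f t = t + of_int e"
        using me [rule_format, of "of_int \<lfloor>t\<rfloor>"] me [rule_format, of t] by simp_all
      then show ?thesis using dc [of "\<lfloor>t\<rfloor>"] by (simp add: d_def)
    qed
    then have "f = (\<lambda>t. t + of_int (lshift f))" by blast
    then show "f \<in> generate thompson_F thompson_gens" using translation_generated by metis
  next
    fix x
    assume IH: "\<And>g. x = nat (lshift g - rshift g) \<Longrightarrow> g \<in> carrier thompson_F \<Longrightarrow> subdivided 0 g
        \<Longrightarrow> g \<in> generate thompson_F thompson_gens"
      and x: "Suc x = nat (lshift f - rshift f)"
    have "\<exists>i. d (i + 1) \<noteq> d i"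
    proof (rule ccontr)
      assume "\<not> ?thesis"
      then have c: "d (i + 1) = d i" for i by blast
      have "d j = d i" if "i \<le> j" for i j using that
        by (induction rule: int_ge_induct) (auto simp: c)
      from this [of "- int M" "int M"] show False using d_left d_right x by simp
    qed
    then obtain i where i: "d (i + 1) \<noteq> d i" by blast
    \<comment> \<open>The inverse of \<open>contract j\<close> doubles the interval from
      \<open>j\<close> to \<open>j + 1\<close>, which contains the image of the left end of a unit
      interval shrunk by \<open>f\<close>.\<close>
    define j where "j = \<lfloor>f (of_int i)\<rfloor>"
    define g where "g = finv (contract j) \<circ> f"
    have g: "g t = max (f t) (min (2 * f t - of_int j) (f t + 1))" for t
      by (simp add: g_def expand_inv)
    have gF: "g \<in> carrier thompson_F"
      unfolding g_def by (intro thompson_F_comp thompson_F_inv contract_in f)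
    have ab: "thompson_ab g = (lshift f, rshift f + 1)"
      unfolding g_def by (simp add: thompson_F_comp(2) thompson_F_inv contract_in f ab_contract)
    have "subdivided 0 g" unfolding subdivided_def
    proof
      fix k :: int
      obtain m e where me: "\<And>t. of_int k \<le> t \<Longrightarrow> t \<le> of_int k + 1 \<Longrightarrow> f t * 2 ^ m = t + of_int e"
        using pc by blast
      have le: "of_int (k + e) \<le> f t * 2 ^ m" "f t * 2 ^ m \<le> of_int (k + e + 1)"
        if "of_int k \<le> t" "t \<le> of_int k + 1" for t using me [OF that] that by simp_all
      \<comment> \<open>The image is a standard dyadic interval of length at most 1, so neither
        \<open>j\<close> nor \<open>j + 1\<close> is in its interior and the inverse of
        \<open>contract j\<close> acts on it by one formula.\<close>
      consider (a) "k + e + 1 \<le> j * 2 ^ m" | (b) "(j + 1) * 2 ^ m \<le> k + e"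
        | (c) "j * 2 ^ m \<le> k + e" "k + e + 1 \<le> (j + 1) * 2 ^ m" by linarith
      then have "\<exists>m::nat. \<exists>e::int. \<forall>t. of_int k \<le> t \<longrightarrow> t \<le> of_int k + 1 \<longrightarrow> g t * 2 ^ m = t + of_int e"
      proof cases
        case a
        then have "of_int (k + e + 1) \<le> (of_int (j * 2 ^ m) :: real)" by (simp only: of_int_le_iff)
        then have "g t = f t" if "of_int k \<le> t" "t \<le> of_int k + 1" for t
        proof -
          have "f t * 2 ^ m \<le> of_int j * 2 ^ m"
            using order_trans [OF le(2) [OF that] \<open>of_int (k + e + 1) \<le> (of_int (j * 2 ^ m) :: real)\<close>]
            unfolding of_int_mult by (simp only: of_int_power of_int_numeral)
          then have "f t \<le> of_int j" by (simp only: mult_pow2_le_iff)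
          then show ?thesis by (simp add: g)
        qed
        then show ?thesis using me by metis
      next
        case b
        then have "of_int ((j + 1) * 2 ^ m) \<le> (of_int (k + e) :: real)"
          by (simp only: of_int_le_iff)
        have "g t = f t + 1" if "of_int k \<le> t" "t \<le> of_int k + 1" for t
        proof -
          have "of_int (j + 1) * 2 ^ m \<le> f t * 2 ^ m"
            using order_trans [OF \<open>of_int ((j + 1) * 2 ^ m) \<le> (of_int (k + e) :: real)\<close> le(1) [OF that]]
            unfolding of_int_mult by (simp only: of_int_power of_int_numeral)
          then have "of_int (j + 1) \<le> f t" by (simp only: mult_pow2_le_iff)
          then show ?thesis by (simp add: g)
        qed
        then have "g t * 2 ^ m = t + of_int (e + 2 ^ m)" if "of_int k \<le> t" "t \<le> of_int k + 1" for t
          using that me [OF that] by (simp add: ring_distribs)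
        then show ?thesis by metis
      next
        case c
        then have "of_int (j * 2 ^ m) \<le> (of_int (k + e) :: real)"
          "of_int (k + e + 1) \<le> (of_int ((j + 1) * 2 ^ m) :: real)"
            by (simp_all only: of_int_le_iff)
        note c' = this
        have gt: "g t = 2 * f t - of_int j" if "of_int k \<le> t" "t \<le> of_int k + 1" for t
        proof -
          have "of_int j * 2 ^ m \<le> f t * 2 ^ m" "f t * 2 ^ m \<le> of_int (j + 1) * 2 ^ m"
            using order_trans [OF c'(1) le(1) [OF that]] order_trans [OF le(2) [OF that] c'(2)]
            unfolding of_int_mult by (simp_all only: of_int_power of_int_numeral)
          then have "of_int j \<le> f t" "f t \<le> of_int (j + 1)"
            by (simp_all only: mult_pow2_le_iff)
          then show ?thesis by (simp add: g)
        qed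
        \<comment> \<open>Doubling lowers the exponent by one. Were the image the whole interval
          from \<open>j\<close> to \<open>j + 1\<close>, the choice of \<open>j\<close> would force
          \<open>k = i\<close>, but \<open>f\<close> shrinks the unit interval starting at
          \<open>i\<close>.\<close>
        have "m \<noteq> 0"
        proof
          assume "m = 0"
          then have "k + e = j" using c by simp
          then have fk: "f (of_int k) = of_int j" "f (of_int k + 1) = of_int j + 1"
            using me [of "of_int k"] me [of "of_int k + 1"] \<open>m = 0\<close> by auto
          then have "f (of_int k) \<le> f (of_int i)" "f (of_int i) < f (of_int k + 1)"
            unfolding j_def by linarith+
          then have "of_int k \<le> (of_int i :: real)" "of_int i < (of_int k + 1 :: real)"
            using strict_mono_less_eq [OF sm] strict_mono_less [OF sm] by blast+
          then have "k = i" by linarith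
          then show False using i fk by (simp add: d_def)
        qed
        then obtain m' where m': "m = Suc m'" using not0_implies_Suc by blast
        have "g t * 2 ^ m' = t + of_int (e - j * 2 ^ m')" if "of_int k \<le> t" "t \<le> of_int k + 1" for t
          using me [OF that] unfolding gt [OF that] m' by (simp add: algebra_simps)
        then show ?thesis by metis
      qed
      then show "\<exists>m::nat. \<exists>e::int. \<forall>t. of_int k \<le> t * 2 ^ 0 \<longrightarrow> t * 2 ^ 0 \<le> of_int k + 1 \<longrightarrow>
          g t * 2 ^ m = t * 2 ^ 0 + of_int e" by simp
    qed
    then have "g \<in> generate thompson_F thompson_gens" using x ab by (intro IH gF) auto
    moreover have "f = contract j \<circ> g"
      using pl2_surj [OF thompson_F_D(1) [OF contract_in]]
      by (auto simp: g_def fun_eq_iff surj_f_inv_f)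
    ultimately show "f \<in> generate thompson_F thompson_gens"
      using generate_comp contract_generated by metis
  }
qed

text \<open>Induction on the subdivision level: each step costs one right factor that is already
  generated.\<close>

lemma thompson_F_generated: "carrier thompson_F = generate thompson_F thompson_gens"
proof
  have *: "f \<in> carrier thompson_F \<Longrightarrow> subdivided n f \<Longrightarrow> f \<in> generate thompson_F thompson_gens" for n f
  proof (induction n arbitrary: f)
    case 0
    then show ?case using subdivided_0_generated by blast
  next
    case (Suc n)
    then obtain g where g: "g \<in> generate thompson_F thompson_gens" "subdivided n (f \<circ> g)"
      using subdivided_Suc by blast
    then have "g \<in> carrier thompson_F"
      using group.generate_in_carrier [OF group_thompson_F thompson_gens_sub] by blast
    then show ?case using Suc.IH g Suc.prems(1) thompson_F_comp(1) generate_cancel_right thompson_gens_sub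
      by blast
  qed
  then show "carrier thompson_F \<subseteq> generate thompson_F thompson_gens" using subdivided_exists
    by blast
  show "generate thompson_F thompson_gens \<subseteq> carrier thompson_F"
    using group.generate_in_carrier [OF group_thompson_F thompson_gens_sub] by blast
qed

section \<open>Subgroups generated by powers\<close>

lemma (in group) inv_commute:
  assumes "x \<otimes> y = y \<otimes> x" "x \<in> carrier G" "y \<in> carrier G"
  shows "inv x \<otimes> y = y \<otimes> inv x"
proof -
  have "inv x \<otimes> y = inv x \<otimes> (y \<otimes> x) \<otimes> inv x" using assms(2,3) by (simp add: m_assoc)
  also have "\<dots> = inv x \<otimes> (x \<otimes> y) \<otimes> inv x" using assms(1) by simp
  also have "\<dots> = y \<otimes> inv x" using assms(2,3) by (simp add: m_assoc [symmetric])
  finally show ?thesis .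
qed

lemma (in group) int_pow_commute:
  assumes "x \<otimes> y = y \<otimes> x" "x \<in> carrier G" "y \<in> carrier G"
  shows "x [^] (i::int) \<otimes> y = y \<otimes> x [^] i"
proof (cases i rule: int_cases2)
  case (nonneg n)
  then show ?thesis using group_commutes_pow [OF assms] by (simp add: int_pow_int)
next
  case (nonpos n)
  then show ?thesis
    using inv_commute [OF group_commutes_pow [OF assms, of n]] assms
    by (simp add: int_pow_neg_int)
qed

text \<open>The relations are those between the elements \<open>contract i\<close> and the unit translation.
  In an exponent-\<open>N\<close> quotient, conjugation by the \<open>N\<close>-th power of \<open>y i\<close> is trivial, so the
  index is periodic, and the condition \<open>i < j\<close> of the conjugation relation becomes void.\<close>

lemma (in group) shift_relations_collapse:
  fixes y :: "int \<Rightarrow> 'a"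
  assumes y: "\<And>i. y i \<in> carrier G"
    and exp: "N > 0" "\<And>x. x \<in> carrier G \<Longrightarrow> x [^] (N::nat) = \<one>"
    and rel: "\<And>i j. i < j \<Longrightarrow> y j \<otimes> y i = y i \<otimes> y (j + 1)"
  shows "y i = y 0"
proof -
  have pow: "y j \<otimes> y i [^] n = y i [^] n \<otimes> y (j + int n)" if "i < j" for i j n
  proof (induction n)
    case 0
    then show ?case using y by simp
  next
    case (Suc n)
    have "y j \<otimes> y i [^] Suc n = (y j \<otimes> y i [^] n) \<otimes> y i" using y by (simp add: m_assoc)
    also have "\<dots> = y i [^] n \<otimes> (y (j + int n) \<otimes> y i)" using Suc y by (simp add: m_assoc)
    also have "\<dots> = y i [^] n \<otimes> (y i \<otimes> y (j + int n + 1))" using rel [of i "j + int n"] that by simp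
    also have "\<dots> = y i [^] Suc n \<otimes> y (j + int (Suc n))" using y by (simp add: m_assoc ac_simps)
    finally show ?case .
  qed
  have per: "y (j + int N) = y j" for j
    using pow [of "j - 1" j N] exp(2) [OF y] y by simp
  have succ: "y (i + 1) = y i" for i
  proof -
    have "y (i + int N) \<otimes> y i = y i \<otimes> y (i + 1 + int N)"
      using rel [of i "i + int N"] exp(1) by (simp add: ac_simps)
    then have "y i \<otimes> y i = y i \<otimes> y (i + 1)" unfolding per .
    then show ?thesis using y by (metis l_cancel)
  qed
  show ?thesis
  proof (induction i rule: int_induct [where k = 0])
    case (step2 i)
    then show ?case using succ [of "i - 1"] by simp
  qed (simp_all add: succ)
qed

text \<open>The map \<open>contract (j + 1)\<close> acts to the right of \<open>j + 1\<close>, which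
  is at least \<open>i + 2\<close>, and there \<open>contract i\<close> is the translation by -1.
  Points up to \<open>j + 1\<close> are sent by \<open>contract i\<close> to points up to
  \<open>j\<close>, which \<open>contract j\<close> fixes.\<close>

lemma contract_comp: "i < j \<Longrightarrow> contract j \<circ> contract i = contract i \<circ> contract (j + 1)"
proof -
  assume "i < j"
  then have "(of_int i :: real) + 1 \<le> of_int j" by linarith
  then show ?thesis by (auto simp: contract_def fun_eq_iff min_def max_def field_simps)
qed

lemma unit_shift_comp_contract: "unit_shift \<circ> contract i = contract (i + 1) \<circ> unit_shift"
  by (auto simp: contract_def unit_shift_def fun_eq_iff min_def max_def field_simps)

section \<open>Quotients of finite exponent\<close>

definition ker_ab :: "(real \<Rightarrow> real) set" where
  "ker_ab = {f \<in> carrier thompson_F. thompson_ab f = (0, 0)}"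

text \<open>In the quotient all contractions have one image \<open>y 0\<close>, which commutes with
  the image \<open>t\<close> of the translation. The quotient map therefore equals a homomorphism
  \<open>q\<close> that depends on the two end translations only and is trivial on
  \<open>ker_ab\<close>.\<close>

lemma ker_ab_subset_normal:
  assumes W: "W \<lhd> thompson_F" and N: "N > 0"
    and pow: "\<And>g. g \<in> carrier thompson_F \<Longrightarrow> g [^]\<^bsub>thompson_F\<^esub> (N::nat) \<in> W"
  shows "ker_ab \<subseteq> W"
proof -
  interpret F: group thompson_F by (rule group_thompson_F)
  interpret W: normal W thompson_F by (rule W)
  let ?Q = "thompson_F Mod W"
  interpret Q: group ?Q by (rule W.factorgroup_is_group)
  define p where "p f = W #>\<^bsub>thompson_F\<^esub> f" for f
  have p_hom: "p \<in> hom thompson_F ?Q" unfolding p_def by (rule W.r_coset_hom_Mod)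
  interpret p: group_hom thompson_F ?Q p
    using p_hom by (intro group_hom.intro group_hom_axioms.intro F.group_axioms Q.group_axioms)
  define y where "y i = p (contract i)" for i
  define t where "t = p unit_shift"
  have y_in: "y i \<in> carrier ?Q" and t_in: "t \<in> carrier ?Q" for i
    unfolding y_def t_def by (simp_all add: contract_in unit_shift_in)
  have exponent: "x [^]\<^bsub>?Q\<^esub> N = \<one>\<^bsub>?Q\<^esub>" if x: "x \<in> carrier ?Q" for x
  proof -
    obtain g where g: "g \<in> carrier thompson_F" "x = W #>\<^bsub>thompson_F\<^esub> g"
      using x by (auto simp: carrier_FactGroup)
    then show ?thesis
      using F.coset_join2 [OF _ W.subgroup_axioms pow [OF g(1)]] by (simp add: W.FactGroup_pow)
  qed
  have rel: "y j \<otimes>\<^bsub>?Q\<^esub> y i = y i \<otimes>\<^bsub>?Q\<^esub> y (j + 1)" if "i < j" for i j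
    unfolding y_def p.hom_mult [OF contract_in contract_in, symmetric]
    using contract_comp [OF that] by simp
  have y: "y i = y 0" for i
    by (rule Q.shift_relations_collapse [where y = y, OF y_in N exponent rel])
  have comm: "y 0 \<otimes>\<^bsub>?Q\<^esub> t = t \<otimes>\<^bsub>?Q\<^esub> y 0"
  proof -
    have "y 1 \<otimes>\<^bsub>?Q\<^esub> t = t \<otimes>\<^bsub>?Q\<^esub> y 0"
      unfolding y_def t_def p.hom_mult [OF contract_in unit_shift_in, symmetric]
        p.hom_mult [OF unit_shift_in contract_in, symmetric]
      using unit_shift_comp_contract [of 0] by simp
    then show ?thesis using y [of 1] by simp
  qed
  have comm': "t [^]\<^bsub>?Q\<^esub> b \<otimes>\<^bsub>?Q\<^esub> y 0 [^]\<^bsub>?Q\<^esub> a = y 0 [^]\<^bsub>?Q\<^esub> a \<otimes>\<^bsub>?Q\<^esub> t [^]\<^bsub>?Q\<^esub> b" for a b :: int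
    using Q.int_pow_commute [OF Q.int_pow_commute [OF comm y_in t_in, symmetric]] y_in t_in by blast
  \<comment> \<open>The exponents solve \<open>(l, r) = (l - r) * (0, -1) + l * (1, 1)\<close>,
    where \<open>(0, -1)\<close> and \<open>(1, 1)\<close> belong to the contractions and the unit
    translation.\<close>
  define q where "q f = y 0 [^]\<^bsub>?Q\<^esub> (lshift f - rshift f) \<otimes>\<^bsub>?Q\<^esub> t [^]\<^bsub>?Q\<^esub> lshift f" for f
  have q_hom: "q \<in> hom thompson_F ?Q"
  proof (rule homI)
    fix f g assume fg: "f \<in> carrier thompson_F" "g \<in> carrier thompson_F"
    let ?a = "\<lambda>f. y 0 [^]\<^bsub>?Q\<^esub> (lshift f - rshift f)" and ?b = "\<lambda>f. t [^]\<^bsub>?Q\<^esub> lshift f"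
    have in_Q: "?a h \<in> carrier ?Q" "?b h \<in> carrier ?Q" for h using y_in t_in by blast+
    have "q f \<otimes>\<^bsub>?Q\<^esub> q g = ?a f \<otimes>\<^bsub>?Q\<^esub> (?b f \<otimes>\<^bsub>?Q\<^esub> ?a g) \<otimes>\<^bsub>?Q\<^esub> ?b g"
      using in_Q unfolding q_def by (metis Q.m_assoc Q.m_closed)
    also have "\<dots> = ?a f \<otimes>\<^bsub>?Q\<^esub> (?a g \<otimes>\<^bsub>?Q\<^esub> ?b f) \<otimes>\<^bsub>?Q\<^esub> ?b g" by (simp only: comm')
    also have "\<dots> = (?a f \<otimes>\<^bsub>?Q\<^esub> ?a g) \<otimes>\<^bsub>?Q\<^esub> (?b f \<otimes>\<^bsub>?Q\<^esub> ?b g)"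
      using in_Q by (metis Q.m_assoc Q.m_closed)
    also have "\<dots> = q (f \<otimes>\<^bsub>thompson_F\<^esub> g)"
      unfolding q_def Q.int_pow_mult [OF y_in, symmetric] Q.int_pow_mult [OF t_in, symmetric]
      using thompson_F_comp(2) [OF fg] by (simp add: algebra_simps)
    finally show "q (f \<otimes>\<^bsub>thompson_F\<^esub> g) = q f \<otimes>\<^bsub>?Q\<^esub> q g" by simp
  qed (use y_in t_in in \<open>unfold q_def, blast\<close>)
  interpret q: group_hom thompson_F ?Q q
    using q_hom by (intro group_hom.intro group_hom_axioms.intro F.group_axioms Q.group_axioms)
  \<comment> \<open>The set where two homomorphisms agree is a subgroup, so comparing them on the
    generators is enough.\<close>
  have sub: "subgroup {f \<in> carrier thompson_F. p f = q f} thompson_F"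
  proof (rule F.subgroupI)
    show "{f \<in> carrier thompson_F. p f = q f} \<noteq> {}"
      using F.one_closed p.hom_one q.hom_one by blast
  qed (auto simp del: mult_thompson_F simp: p.hom_mult q.hom_mult p.hom_inv q.hom_inv)
  have "q (contract i) = p (contract i)" for i
    using y [of i] y_in t_in unfolding q_def y_def [symmetric] ab_contract
      by (simp del: one_FactGroup mult_FactGroup)
  moreover have "q unit_shift = p unit_shift"
    using y_in t_in unfolding q_def t_def [symmetric] ab_unit_shift
      by (simp del: one_FactGroup mult_FactGroup)
  ultimately have "thompson_gens \<subseteq> {f \<in> carrier thompson_F. p f = q f}"
    using thompson_gens_sub by auto
  then have all: "carrier thompson_F \<subseteq> {f \<in> carrier thompson_F. p f = q f}"
    using F.generate_subgroup_incl [OF _ sub] thompson_F_generated by blast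
  show ?thesis
  proof
    fix f assume "f \<in> ker_ab"
    then have f: "f \<in> carrier thompson_F" "thompson_ab f = (0, 0)" by (auto simp: ker_ab_def)
    then have "p f = \<one>\<^bsub>?Q\<^esub>" using all unfolding q_def
      by (auto simp del: one_FactGroup mult_FactGroup)
    then show "f \<in> W" using F.coset_join1 [OF _ f(1) W.subgroup_axioms] by (simp add: p_def)
  qed
qed

section \<open>Power subgroups and recovery of the kernel\<close>

definition power_subgroup :: "('a, 'b) monoid_scheme \<Rightarrow> nat \<Rightarrow> 'a set" where
  "power_subgroup G N = generate G ((\<lambda>g. g [^]\<^bsub>G\<^esub> N) ` carrier G)"

lemma (in group_hom) power_subgroup_img: "h ` power_subgroup G N \<subseteq> power_subgroup H N"
proof -
  have "h ` power_subgroup G N = generate H (h ` (\<lambda>g. g [^]\<^bsub>G\<^esub> N) ` carrier G)"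
    unfolding power_subgroup_def by (rule generate_img [symmetric]) auto
  also have "\<dots> \<subseteq> power_subgroup H N"
    unfolding power_subgroup_def by (rule H.mono_generate) (auto simp: hom_nat_pow)
  finally show ?thesis .
qed

text \<open>A conjugate of an \<open>N\<close>-th power is the \<open>N\<close>-th power of a
  conjugate, so the generating set is itself invariant.\<close>

lemma (in group) power_subgroup_normal: "power_subgroup G N \<lhd> G"
  unfolding power_subgroup_def
proof (rule normal_generateI)
  fix h g assume "h \<in> (\<lambda>g. g [^] N) ` carrier G" and g: "g \<in> carrier G"
  then obtain x where x: "x \<in> carrier G" "h = x [^] N" by blast
  have "(g \<otimes> x \<otimes> inv g) [^] n = g \<otimes> x [^] n \<otimes> inv g" for n :: nat
  proof (induction n)
    case (Suc n)
    have "(g \<otimes> x [^] n \<otimes> inv g) \<otimes> (g \<otimes> x \<otimes> inv g) = g \<otimes> (x [^] n \<otimes> ((inv g \<otimes> g) \<otimes> x)) \<otimes> inv g"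
      using x g by (simp only: m_assoc m_closed inv_closed nat_pow_closed)
    then show ?case using Suc x g by simp
  qed (use g in simp)
  then show "g \<otimes> h \<otimes> inv g \<in> (\<lambda>g. g [^] N) ` carrier G" using x g
    by (metis image_eqI inv_closed m_closed)
qed auto

text \<open>By the pigeonhole principle two of the powers of \<open>g\<close> with exponents from 0
  to the index lie in one coset. Hence a positive power with exponent at most the index is in
  \<open>U\<close>, and this exponent divides the factorial of the index, which is independent of
  \<open>g\<close>.\<close>

lemma (in group) finite_index_power:
  assumes U: "subgroup U G" and fin: "finite (rcosets U)"
  shows "\<exists>M>0. \<forall>g\<in>carrier G. g [^] (M::nat) \<in> U"
proof -
  interpret U: subgroup U G by (rule U)
  let ?n = "card (rcosets U)"
  have "g [^] (fact ?n :: nat) \<in> U" if g: "g \<in> carrier G" for g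
  proof -
    have sub: "(\<lambda>i::nat. U #> g [^] i) ` {..?n} \<subseteq> rcosets U" using g by (auto simp: RCOSETS_def)
    have "\<not> inj_on (\<lambda>i::nat. U #> g [^] i) {..?n}"
    proof
      assume "inj_on (\<lambda>i::nat. U #> g [^] i) {..?n}"
      then have "card {..?n} \<le> ?n" using card_inj_on_le [OF _ sub fin] by blast
      then show False by simp
    qed
    then obtain i j :: nat where ij: "i \<le> ?n" "j \<le> ?n" "i < j" "U #> g [^] i = U #> g [^] j"
      unfolding inj_on_def by (metis atMost_iff linorder_neqE_nat)
    have "g [^] j = g [^] (j - i) \<otimes> g [^] i" using ij g by (simp add: nat_pow_mult)
    then have "g [^] (j - i) = g [^] j \<otimes> inv (g [^] i)" using g by (simp add: m_assoc)
    moreover have "U #> (g [^] j \<otimes> inv (g [^] i)) = U"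
      using coset_mult_inv2 [OF ij(4) [symmetric]] g U.subset by simp
    ultimately have mem: "g [^] (j - i) \<in> U" using coset_join1 [OF _ _ U] g
      by (metis nat_pow_closed)
    have "j - i dvd fact ?n" using ij by (intro dvd_fact) auto
    then obtain k where "fact ?n = (j - i) * k" by (auto elim: dvdE)
    then have "g [^] (fact ?n :: nat) = (g [^] (j - i)) [^] k" using g by (simp add: nat_pow_pow)
    also have "\<dots> \<in> U" using mem by (induction k) auto
    finally show ?thesis .
  qed
  then show ?thesis by (intro exI [of _ "fact ?n"]) simp
qed

lemma ker_ab_subset_power_subgroup: "N > 0 \<Longrightarrow> ker_ab \<subseteq> power_subgroup thompson_F N"
  by (rule ker_ab_subset_normal [OF group.power_subgroup_normal [OF group_thompson_F]])
    (auto simp: power_subgroup_def intro: generate.incl)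

lemma ab_pow:
  assumes "f \<in> carrier thompson_F"
  shows "thompson_ab (f [^]\<^bsub>thompson_F\<^esub> (n::nat)) = (int n * lshift f, int n * rshift f)"
proof -
  interpret group thompson_F by (rule group_thompson_F)
  show ?thesis
  proof (induction n)
    case (Suc n)
    have "thompson_ab (f [^]\<^bsub>thompson_F\<^esub> n \<circ> f) = (int n * lshift f + lshift f, int n * rshift f + rshift f)"
      using thompson_F_comp(2) [OF nat_pow_closed [OF assms] assms, of n] Suc by simp
    moreover have "int (Suc n) * x = int n * x + x" for x by (simp add: ring_distribs)
    ultimately show ?case by (simp only: nat_pow_Suc mult_thompson_F)
  qed (simp add: ab_id [unfolded id_def])
qed

lemma power_subgroup_ab:
  assumes "f \<in> power_subgroup thompson_F N"
  shows "int N dvd lshift f" "int N dvd rshift f"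
proof -
  interpret group thompson_F by (rule group_thompson_F)
  let ?S = "{f \<in> carrier thompson_F. int N dvd lshift f \<and> int N dvd rshift f}"
  have "subgroup ?S thompson_F"
  proof (rule subgroupI)
    have "id \<in> ?S" using one_closed by (simp add: ab_id)
    then show "?S \<noteq> {}" by blast
  qed (auto simp: m_inv_thompson_F thompson_F_inv thompson_F_comp)
  then have "power_subgroup thompson_F N \<subseteq> ?S"
    unfolding power_subgroup_def by (intro generate_subgroup_incl) (auto simp: ab_pow)
  then show "int N dvd lshift f" "int N dvd rshift f" using assms by auto
qed

text \<open>The \<open>N\<close>-th powers of elements of \<open>U\<close> include the
  \<open>M * N\<close>-th powers of the whole group, which gives one inclusion. For the other, an
  end translation divisible by every positive \<open>N\<close> is zero.\<close>

lemma power_residual_eq_ker_ab: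
  assumes U: "subgroup U thompson_F" and M: "M > 0"
    "\<And>g. g \<in> carrier thompson_F \<Longrightarrow> g [^]\<^bsub>thompson_F\<^esub> (M::nat) \<in> U"
  shows "(\<Inter>N\<in>{0<..}. power_subgroup (thompson_F\<lparr>carrier := U\<rparr>) N) = ker_ab"
proof -
  interpret group thompson_F by (rule group_thompson_F)
  interpret U: subgroup U thompson_F by (rule U)
  have eq: "power_subgroup (thompson_F\<lparr>carrier := U\<rparr>) N =
      generate thompson_F ((\<lambda>g. g [^]\<^bsub>thompson_F\<^esub> N) ` U)" for N
  proof -
    have "g [^]\<^bsub>thompson_F\<^esub> N \<in> U" if "g \<in> U" for g using that 
      by (induction N) (auto simp del: mult_thompson_F one_thompson_F)
    then show ?thesis
      unfolding power_subgroup_def nat_pow_consistent [symmetric]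
      by (simp add: generate_consistent [OF _ U] image_subset_iff)
  qed
  have "ker_ab \<subseteq> power_subgroup (thompson_F\<lparr>carrier := U\<rparr>) N" if "N > 0" for N
  proof -
    have "g [^]\<^bsub>thompson_F\<^esub> (M * N) \<in> (\<lambda>g. g [^]\<^bsub>thompson_F\<^esub> N) ` U" if "g \<in> carrier thompson_F" for g
      using M(2) [OF that] nat_pow_pow [OF that, of M N] by (metis image_eqI)
    then have "power_subgroup thompson_F (M * N) \<subseteq> power_subgroup (thompson_F\<lparr>carrier := U\<rparr>) N"
      unfolding eq power_subgroup_def [of thompson_F] by (intro mono_generate) auto
    then show ?thesis using ker_ab_subset_power_subgroup [of "M * N"] that M(1) by simp
  qed
  moreover have "f \<in> ker_ab" if f: "\<And>N. N > 0 \<Longrightarrow> f \<in> power_subgroup (thompson_F\<lparr>carrier := U\<rparr>) N" for f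
  proof -
    have "power_subgroup (thompson_F\<lparr>carrier := U\<rparr>) N \<subseteq> power_subgroup thompson_F N" for N
      unfolding eq power_subgroup_def [of thompson_F] using U.subset by (intro mono_generate) auto
    then have fN: "f \<in> power_subgroup thompson_F N" if "N > 0" for N using f that by blast
    \<comment> \<open>Exceeds both absolute values, so divisibility forces both translations to
      vanish.\<close>
    let ?N = "nat (\<bar>lshift f\<bar> + \<bar>rshift f\<bar> + 1)"
    have "int ?N dvd lshift f" "int ?N dvd rshift f" using power_subgroup_ab [OF fN [of ?N]]
      by simp_all
    then have "lshift f = 0" "rshift f = 0"
      using dvd_imp_le_int [of "lshift f" "int ?N"] dvd_imp_le_int [of "rshift f" "int ?N"]
        by fastforce+
    moreover have "f \<in> carrier thompson_F"
      using fN [of 1] unfolding power_subgroup_def by (intro generate_in_carrier) auto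
    ultimately show ?thesis by (simp add: ker_ab_def prod_eq_iff)
  qed
  ultimately show ?thesis by auto
qed

section \<open>Finite-index subgroups isomorphic to the whole group\<close>

text \<open>A nontrivial element of the kernel supported between \<open>i\<close> and
  \<open>i + 2\<close>: beyond this interval the two factors cancel.\<close>

definition bump :: "int \<Rightarrow> real \<Rightarrow> real" where
  "bump i = contract i \<circ> finv (contract (i + 1))"

lemma bump_in: "bump i \<in> ker_ab"
  unfolding ker_ab_def bump_def
  by (simp add: thompson_F_comp thompson_F_inv contract_in ab_contract)

lemma bump_outside: "t \<le> of_int i \<or> of_int i + 2 \<le> t \<Longrightarrow> bump i t = t"
  by (auto simp: bump_def expand_inv contract_def min_def max_def)

lemma bump_neq_id: "bump i \<noteq> id"
proof
  assume "bump i = id"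
  then have "bump i (of_int i + 1) = of_int i + 1" by simp
  then show False by (auto simp: bump_def expand_inv contract_def min_def max_def split: if_splits)
qed

text \<open>By monotonicity \<open>f\<close> maps each outer half line into itself and
  \<open>g\<close> maps the interval from \<open>a\<close> to \<open>b\<close> into itself, so at
  every point at least one of the maps does nothing.\<close>

lemma disjoint_support_commute:
  assumes f: "strict_mono f" "\<And>t. a \<le> t \<Longrightarrow> t \<le> b \<Longrightarrow> f t = t"
    and g: "strict_mono g" "\<And>t. t \<le> a \<or> b \<le> t \<Longrightarrow> g t = t"
    and "a \<le> (b::real)"
  shows "g \<circ> f = f \<circ> g"
proof
  fix t
  note less_eq = strict_mono_less_eq [OF f(1)] strict_mono_less_eq [OF g(1)]
  consider "t \<le> a" | "a \<le> t" "t \<le> b" | "b \<le> t" by linarith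
  then show "(g \<circ> f) t = (f \<circ> g) t"
  proof cases
    case 1
    then have "f t \<le> a" using less_eq(1) [of t a] f(2) [of a] \<open>a \<le> b\<close> by simp
    then show ?thesis using 1 g(2) by simp
  next
    case 2
    then have "a \<le> g t" "g t \<le> b" using less_eq(2) [of a t] less_eq(2) [of t b] g(2) [of a] g(2) [of b]
      by simp_all
    then show ?thesis using 2 f(2) by simp
  next
    case 3
    then have "b \<le> f t" using less_eq(1) [of b t] f(2) [of b] \<open>a \<le> b\<close> by simp
    then show ?thesis using 3 g(2) by simp
  qed
qed

text \<open>Increasing bijections carry least upper bounds to least upper bounds, and
  \<open>A\<close> is invariant.\<close>

lemma strict_mono_fixes_Sup:
  assumes f: "strict_mono (f::real\<Rightarrow>real)" "surj f"
    and A: "\<And>s. f s \<in> A \<longleftrightarrow> s \<in> A" "A \<noteq> {}" "bdd_above A"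
  shows "f (Sup A) = Sup A"
proof (rule antisym)
  have "s \<le> f (Sup A)" if "s \<in> A" for s
  proof -
    obtain s' where "s = f s'" using f(2) by auto
    then show ?thesis
      using that A(1) cSup_upper [OF _ A(3)] strict_mono_less_eq [OF f(1)] by blast
  qed
  then show "Sup A \<le> f (Sup A)" using A(2) by (intro cSup_least)
  have "s \<le> finv f (Sup A)" if "s \<in> A" for s
  proof -
    have "f s \<le> f (finv f (Sup A))"
      using that A(1) cSup_upper [OF _ A(3)] by (simp add: surj_f_inv_f [OF f(2)])
    then show ?thesis using strict_mono_less_eq [OF f(1)] by blast
  qed
  then have "Sup A \<le> finv f (Sup A)" using A(2) by (intro cSup_least)
  then show "f (Sup A) \<le> Sup A"
    using strict_mono_less_eq [OF f(1), of "Sup A" "finv f (Sup A)"]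
      by (simp add: surj_f_inv_f [OF f(2)])
qed

lemma strict_mono_fixes_Inf:
  assumes f: "strict_mono (f::real\<Rightarrow>real)" "surj f"
    and A: "\<And>s. f s \<in> A \<longleftrightarrow> s \<in> A" "A \<noteq> {}" "bdd_below A"
  shows "f (Inf A) = Inf A"
proof -
  let ?f = "\<lambda>t. - f (- t)"
  have "strict_mono ?f" using f(1) by (simp add: strict_mono_def)
  moreover have "surj ?f"
  proof (rule surjI)
    show "- f (- (- finv f (- y))) = y" for y by (simp add: surj_f_inv_f [OF f(2)])
  qed
  moreover have "?f s \<in> uminus ` A \<longleftrightarrow> s \<in> uminus ` A" for s
    using A(1) [of "- s"] by (metis image_iff minus_minus)
  ultimately have "?f (Sup (uminus ` A)) = Sup (uminus ` A)"
    using A(2,3) by (intro strict_mono_fixes_Sup) auto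
  then show ?thesis by (simp add: Inf_real_def)
qed

section \<open>One-sided elements\<close>

definition one_sided :: "(real \<Rightarrow> real) \<Rightarrow> bool" where
  "one_sided f \<longleftrightarrow> lshift f = 0 \<or> rshift f = 0"

lemma ker_ab_shifts: "f \<in> ker_ab \<longleftrightarrow> f \<in> carrier thompson_F \<and> lshift f = 0 \<and> rshift f = 0"
  by (auto simp: ker_ab_def prod_eq_iff)

text \<open>This describes \<^const>\<open>one_sided\<close> in group-theoretic terms: if both end translations are
  nontrivial, the coset of \<open>f\<close> contains an element with a single fixed point, and the hull of the
  support of an element commuting with it would have two fixed end points.\<close>

lemma one_sided_iff_commuting:
  assumes f: "f \<in> carrier thompson_F"
  shows "one_sided f \<longleftrightarrow> (\<forall>k\<in>ker_ab. \<exists>g\<in>ker_ab. g \<noteq> id \<and> g \<circ> (f \<circ> k) = (f \<circ> k) \<circ> g)"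
proof
  assume one: "one_sided f"
  show "\<forall>k\<in>ker_ab. \<exists>g\<in>ker_ab. g \<noteq> id \<and> g \<circ> (f \<circ> k) = (f \<circ> k) \<circ> g"
  proof
    fix k assume "k \<in> ker_ab"
    then have k: "k \<in> carrier thompson_F" "lshift k = 0" "rshift k = 0"
      by (auto simp: ker_ab_shifts)
    let ?h = "f \<circ> k"
    have h: "?h \<in> carrier thompson_F" using f k thompson_F_comp by blast
    have hlr: "lshift ?h = 0 \<or> rshift ?h = 0"
      using one thompson_F_comp(2) [OF f k(1)] k by (simp add: one_sided_def)
    obtain M where M: "\<And>t. t \<le> - real M \<Longrightarrow> ?h t = t + of_int (lshift ?h)"
      "\<And>t. t \<ge> real M \<Longrightarrow> ?h t = t + of_int (rshift ?h)"
      using thompson_F_translation_bound [OF h] by blast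
    \<comment> \<open>Near an end with trivial translation the map is the identity, which leaves
      room of length 2 for a bump.\<close>
    have ex: "\<exists>i::int. \<forall>t. of_int i \<le> t \<longrightarrow> t \<le> of_int i + 2 \<longrightarrow> ?h t = t"
      using hlr
    proof
      assume "lshift ?h = 0"
      then show ?thesis using M(1) by (intro exI [of _ "- int M - 2"]) simp
    next
      assume "rshift ?h = 0"
      then show ?thesis using M(2) by (intro exI [of _ "int M"]) simp
    qed
    then obtain i :: int where i: "\<And>t. of_int i \<le> t \<Longrightarrow> t \<le> of_int i + 2 \<Longrightarrow> ?h t = t" by blast
    have "bump i \<in> carrier thompson_F" using bump_in by (simp add: ker_ab_shifts)
    then have "bump i \<circ> ?h = ?h \<circ> bump i"
      using h thompson_F_D(1) pl2_strict_mono bump_outside i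
      by (intro disjoint_support_commute [of _ "of_int i" "of_int i + 2"]) auto
    then show "\<exists>g\<in>ker_ab. g \<noteq> id \<and> g \<circ> ?h = ?h \<circ> g" using bump_in bump_neq_id by blast
  qed
next
  assume comm: "\<forall>k\<in>ker_ab. \<exists>g\<in>ker_ab. g \<noteq> id \<and> g \<circ> (f \<circ> k) = (f \<circ> k) \<circ> g"
  show "one_sided f"
  proof (rule ccontr)
    assume "\<not> one_sided f"
    then have lr: "lshift f \<noteq> 0" "rshift f \<noteq> 0" by (auto simp: one_sided_def)
    \<comment> \<open>Lies in the coset of \<open>f\<close> modulo \<open>ker_ab\<close> and has 0
      as its only fixed point.\<close>
    define e where "e = end_shifts (lshift f) (rshift f)"
    have e: "e \<in> carrier thompson_F" "thompson_ab e = (lshift f, rshift f)"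
      unfolding e_def by (rule end_shifts_in ab_end_shifts)+
    have e_fix: "e t = t \<longleftrightarrow> t = 0" for t unfolding e_def using end_shifts_fixed [OF lr] .
    have "finv f \<circ> e \<in> ker_ab"
      using thompson_F_comp [OF thompson_F_inv(1) [OF f] e(1)] thompson_F_inv(2) [OF f] e(2)
      by (simp add: ker_ab_def)
    moreover have "f \<circ> (finv f \<circ> e) = e"
      using pl2_surj [OF thompson_F_D(1) [OF f]] by (simp add: fun_eq_iff surj_f_inv_f)
    ultimately obtain g where g: "g \<in> ker_ab" "g \<noteq> id" "g \<circ> e = e \<circ> g" using comm by metis
    have sm: "strict_mono e" "surj e" "inj e" using thompson_F_D(1) [OF e(1)] pl2_strict_mono pl2_surj pl2_inj
      by auto
    define A where "A = {s. g s \<noteq> s}"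
    have "g (e s) = e (g s)" for s using g(3) by (metis comp_apply)
    then have A: "e s \<in> A \<longleftrightarrow> s \<in> A" for s using sm(3) by (auto simp: A_def inj_eq)
    \<comment> \<open>As \<open>g\<close> commutes with \<open>e\<close>, it preserves the fixed
      point set of \<open>e\<close>, the single point 0.\<close>
    have "e (g 0) = g 0" using \<open>\<And>s. g (e s) = e (g s)\<close> [of 0] e_fix [of 0] by simp
    then have "g 0 = 0" using e_fix by blast
    obtain t where t: "t \<in> A" using g(2) by (auto simp: A_def fun_eq_iff)
    then have "t \<noteq> 0" using \<open>g 0 = 0\<close> by (auto simp: A_def)
    have "g \<in> carrier thompson_F" "lshift g = 0" "rshift g = 0" using g(1)
      by (auto simp: ker_ab_shifts)
    then obtain M where M: "\<And>t. t \<le> - real M \<Longrightarrow> g t = t" "\<And>t. t \<ge> real M \<Longrightarrow> g t = t"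
      using thompson_F_translation_bound [of g] by (metis add.right_neutral of_int_0)
    have bdd: "bdd_above A" "bdd_below A"
      using M unfolding A_def
        by (auto intro!: bdd_aboveI [of _ "real M"] bdd_belowI [of _ "- real M"]) (meson linear)+
    show False
    \<comment> \<open>According to the sign of the moved point \<open>t\<close>, the supremum or the
      infimum of the support is a fixed point of \<open>e\<close> other than 0.\<close>
    proof (cases "t > 0")
      case True
      have "e (Sup A) = Sup A" using strict_mono_fixes_Sup [OF sm(1,2) A _ bdd(1)] t by blast
      then have "Sup A = 0" using e_fix by blast
      then show False using True cSup_upper [OF t bdd(1)] by simp
    next
      case False
      have "e (Inf A) = Inf A" using strict_mono_fixes_Inf [OF sm(1,2) A _ bdd(2)] t by blast
      then have "Inf A = 0" using e_fix by blast
      then show False using False \<open>t \<noteq> 0\<close> cInf_lower [OF t bdd(2)] by simp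
    qed
  qed
qed

text \<open>The commutation criterion speaks only of products, the identity and
  \<open>ker_ab\<close>; an injective homomorphism that maps \<open>ker_ab\<close> onto itself
  transports its witnesses.\<close>

lemma hom_preserves_one_sided:
  assumes h: "h \<in> hom thompson_F (thompson_F\<lparr>carrier := U\<rparr>)" "inj_on h (carrier thompson_F)"
    and U: "subgroup U thompson_F" and ker: "h ` ker_ab = ker_ab"
    and f: "f \<in> carrier thompson_F" "one_sided f"
  shows "one_sided (h f)"
proof -
  interpret F: group thompson_F by (rule group_thompson_F)
  interpret h: group_hom thompson_F "thompson_F\<lparr>carrier := U\<rparr>" h
    using h(1) F.subgroup_imp_group [OF U]
      by (intro group_hom.intro group_hom_axioms.intro F.group_axioms)
  have mult: "h (x \<circ> y) = h x \<circ> h y" if "x \<in> carrier thompson_F" "y \<in> carrier thompson_F" for x y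
    using h.hom_mult [OF that] by simp
  have one: "h id = id" using h.hom_one by simp
  have ker_F: "k \<in> carrier thompson_F" if "k \<in> ker_ab" for k using that by (simp add: ker_ab_def)
  have hf: "h f \<in> carrier thompson_F" using h.hom_closed [OF f(1)] subgroup.subset [OF U] by auto
  show ?thesis unfolding one_sided_iff_commuting [OF hf]
  proof
    fix k' assume "k' \<in> ker_ab"
    then obtain k where k: "k \<in> ker_ab" "k' = h k" using ker by blast
    obtain g where g: "g \<in> ker_ab" "g \<noteq> id" "g \<circ> (f \<circ> k) = (f \<circ> k) \<circ> g"
      using f k(1) one_sided_iff_commuting by blast
    have fk: "f \<circ> k \<in> carrier thompson_F" using f ker_F [OF k(1)] thompson_F_comp by blast
    have "h g \<circ> (h f \<circ> k') = (h f \<circ> k') \<circ> h g"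
      using arg_cong [OF g(3), of h] fk ker_F [OF g(1)] ker_F [OF k(1)] f(1) unfolding k(2)
        by (simp only: mult)
    moreover have "h g \<noteq> id"
      using g ker_F one F.one_closed inj_onD [OF h(2), of g id] by auto
    ultimately show "\<exists>g\<in>ker_ab. g \<noteq> id \<and> g \<circ> (h f \<circ> k') = (h f \<circ> k') \<circ> g" using ker g(1) by blast
  qed
qed

text \<open>Division with remainder by the least positive element, which exists because of
  \<open>m\<close>.\<close>

lemma int_subgroup_cyclic:
  assumes diff: "\<And>x y. x \<in> A \<Longrightarrow> y \<in> A \<Longrightarrow> x - y \<in> A" and m: "m \<in> A" "(m::int) > 0"
  shows "\<exists>p>0. A = range ((*) p)"
proof -
  have 0: "0 \<in> A" using diff [OF m(1) m(1)] by simp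
  have neg: "- x \<in> A" if "x \<in> A" for x using diff [OF 0 that] by simp
  have add: "x + y \<in> A" if "x \<in> A" "y \<in> A" for x y using diff [OF that(1) neg [OF that(2)]] by simp
  define n where "n = (LEAST n::nat. n > 0 \<and> int n \<in> A)"
  have "nat m > 0 \<and> int (nat m) \<in> A" using m by simp
  then have n: "n > 0" "int n \<in> A" unfolding n_def by (metis (mono_tags, lifting) LeastI)+
  have least: "\<not> (k > 0 \<and> int k \<in> A)" if "k < n" for k
    using not_less_Least [of k "\<lambda>n. n > 0 \<and> int n \<in> A"] that unfolding n_def by blast
  have mult: "int n * k \<in> A" for k
  proof (induction k rule: int_induct [where k = 0])
    case (step1 i)
    then show ?case using add [OF step1(2) n(2)] by (simp add: ring_distribs)
  next
    case (step2 i)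
    then show ?case using diff [OF step2(2) n(2)] by (simp add: ring_distribs)
  qed (simp add: 0)
  have "x \<in> range ((*) (int n))" if x: "x \<in> A" for x
  proof -
    have "x mod int n = x - int n * (x div int n)" by (simp add: minus_mult_div_eq_mod)
    then have "x mod int n \<in> A" using diff [OF x mult] by metis
    moreover have "0 \<le> x mod int n" "x mod int n < int n" using n(1) by simp_all
    ultimately have "x mod int n = 0" using least [of "nat (x mod int n)"] by auto
    then show ?thesis by (metis mult_div_mod_eq add.right_neutral rangeI)
  qed
  then have "A = range ((*) (int n))" using mult by auto
  then show ?thesis using n(1) by (intro exI [of _ "int n"]) simp
qed

section \<open>From an isomorphism to a product of two subgroups of the integers\<close>

lemma finite_index_iso_imp_rectangular:
  assumes U: "subgroup U thompson_F" and fin: "finite (rcosets\<^bsub>thompson_F\<^esub> U)"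
    and iso: "thompson_F\<lparr>carrier := U\<rparr> \<cong> thompson_F"
  shows "\<exists>p q :: int. p > 0 \<and> q > 0 \<and> U = thompson_sub p q"
proof -
  interpret F: group thompson_F by (rule group_thompson_F)
  interpret U: subgroup U thompson_F by (rule U)
  let ?U = "thompson_F\<lparr>carrier := U\<rparr>"
  interpret UG: group ?U by (rule F.subgroup_imp_group [OF U])
  obtain M :: nat where M: "M > 0" "\<And>g. g \<in> carrier thompson_F \<Longrightarrow> g [^]\<^bsub>thompson_F\<^esub> M \<in> U"
    using F.finite_index_power [OF U fin] by blast
  have res_U: "(\<Inter>N\<in>{0<..}. power_subgroup ?U N) = ker_ab"
    by (rule power_residual_eq_ker_ab [OF U M])
  have res_F: "(\<Inter>N\<in>{0<..}. power_subgroup thompson_F N) = ker_ab"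
    using power_residual_eq_ker_ab [OF F.subgroup_self, of 1] by simp
  \<comment> \<open>The term with \<open>N = 1\<close> already places the whole intersection inside
    \<open>U\<close>.\<close>
  have "power_subgroup ?U 1 \<subseteq> U"
    unfolding power_subgroup_def using UG.generate_incl [of "(\<lambda>g. g [^]\<^bsub>?U\<^esub> (1::nat)) ` carrier ?U"]
      by auto
  then have ker_U: "ker_ab \<subseteq> U" using res_U by auto
  obtain h where h: "h \<in> iso thompson_F ?U"
    using UG.iso_sym [OF iso] by (auto simp: is_iso_def)
  then have h_hom: "h \<in> hom thompson_F ?U" and h_bij: "bij_betw h (carrier thompson_F) U"
    by (auto simp: iso_def)
  define h' where "h' = inv_into (carrier thompson_F) h"
  have h': "h' \<in> hom ?U thompson_F" using F.iso_set_sym [OF h] by (auto simp: h'_def iso_def)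
  interpret h: group_hom thompson_F ?U h
    using h_hom by (intro group_hom.intro group_hom_axioms.intro F.group_axioms UG.group_axioms)
  interpret h': group_hom ?U thompson_F h'
    using h' by (intro group_hom.intro group_hom_axioms.intro F.group_axioms UG.group_axioms)
  \<comment> \<open>Homomorphisms respect every power subgroup, and the kernel is the intersection
    of the power subgroups both in the whole group and in \<open>U\<close>.\<close>
  have sub: "h ` ker_ab \<subseteq> ker_ab"
  proof
    fix y assume "y \<in> h ` ker_ab"
    then obtain x where x: "x \<in> ker_ab" "y = h x" by blast
    then have "x \<in> power_subgroup thompson_F N" if "N > 0" for N using res_F that by blast
    then have "y \<in> power_subgroup ?U N" if "N > 0" for N using h.power_subgroup_img x(2) that
      by blast
    then show "y \<in> ker_ab" using res_U by blast
  qed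
  have "h' ` ker_ab \<subseteq> ker_ab"
  proof
    fix y assume "y \<in> h' ` ker_ab"
    then obtain x where x: "x \<in> ker_ab" "y = h' x" by blast
    then have "x \<in> power_subgroup ?U N" if "N > 0" for N using res_U that by blast
    then have "y \<in> power_subgroup thompson_F N" if "N > 0" for N using h'.power_subgroup_img x(2) that
      by blast
    then show "y \<in> ker_ab" using res_F by blast
  qed
  have "ker_ab \<subseteq> h ` ker_ab"
  proof
    fix x assume x: "x \<in> ker_ab"
    then have "h (h' x) = x" using ker_U h_bij unfolding h'_def
      by (auto simp: bij_betw_def f_inv_into_f)
    then show "x \<in> h ` ker_ab" using \<open>h' ` ker_ab \<subseteq> ker_ab\<close> x by (metis image_eqI image_subset_iff)
  qed
  with sub have ker: "h ` ker_ab = ker_ab" by blast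
  have one: "one_sided (h f)" if "f \<in> carrier thompson_F" "one_sided f" for f
    using hom_preserves_one_sided [OF h_hom _ U ker that] h_bij by (simp add: bij_betw_def)
  have mult: "h (x \<circ> y) = h x \<circ> h y" if "x \<in> carrier thompson_F" "y \<in> carrier thompson_F" for x y
    using h.hom_mult [OF that] by simp
  have h_U: "h x \<in> U" if "x \<in> carrier thompson_F" for x using h.hom_closed [OF that] by simp
  have U_F: "x \<in> carrier thompson_F" if "x \<in> U" for x using that U.subset by blast
  \<comment> \<open>The preimage of \<open>u\<close> under \<open>h\<close> is factored into an
    element trivial at the right end and one trivial at the left end; their images are one-sided
    again.\<close>
  have split: "(\<exists>v\<in>U. lshift v = lshift u \<and> rshift v = 0) \<and> (\<exists>w\<in>U. lshift w = 0 \<and> rshift w = rshift u)"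
    if u: "u \<in> U" for u
  proof -
    obtain f where f: "f \<in> carrier thompson_F" "u = h f" using u h_bij by (auto simp: bij_betw_def)
    define f2 where "f2 = end_shifts 0 (rshift f)"
    define f1 where "f1 = f \<circ> finv f2"
    have f2: "f2 \<in> carrier thompson_F" "thompson_ab f2 = (0, rshift f)"
      unfolding f2_def by (rule end_shifts_in ab_end_shifts)+
    have f1: "f1 \<in> carrier thompson_F" "thompson_ab f1 = (lshift f, 0)"
      unfolding f1_def using thompson_F_comp [OF f(1) thompson_F_inv(1) [OF f2(1)]] thompson_F_inv(2) [OF f2(1)] f2(2)
      by simp_all
    have "f = f1 \<circ> f2"
      unfolding f1_def using pl2_inj [OF thompson_F_D(1) [OF f2(1)]]
        by (simp add: fun_eq_iff inv_f_f)
    then have u12: "u = h f1 \<circ> h f2" using f f1 f2 mult by metis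
    have ab_u: "thompson_ab u = (lshift (h f1) + lshift (h f2), rshift (h f1) + rshift (h f2))"
      unfolding u12 by (intro thompson_F_comp(2) U_F h_U f1 f2)
    have id: "id \<in> U" using U.one_closed by (simp only: one_thompson_F)
    have hU: "h f1 \<in> U" "h f2 \<in> U" using h_U f1 f2 by auto
    have "lshift (h f1) = 0 \<or> rshift (h f1) = 0" "lshift (h f2) = 0 \<or> rshift (h f2) = 0"
      using one [OF f1(1)] one [OF f2(1)] f1(2) f2(2) unfolding one_sided_def by simp_all
    \<comment> \<open>If both images are trivial at the same end, \<open>u\<close> and the identity
      are the witnesses; if they are trivial at opposite ends, the images themselves are.\<close>
    then consider (a) "lshift (h f1) = 0" "lshift (h f2) = 0" | (b) "rshift (h f1) = 0" "rshift (h f2) = 0"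
      | (c) "lshift (h f1) = 0" "rshift (h f2) = 0" | (d) "rshift (h f1) = 0" "lshift (h f2) = 0"
        by blast
    then show ?thesis
    proof cases
      case a
      then show ?thesis using u id ab_u
        by (intro conjI bexI [of _ id] bexI [of _ u]) (simp_all only: ab_id fst_conv snd_conv)
    next
      case b
      then show ?thesis using u id ab_u
        by (intro conjI bexI [of _ id] bexI [of _ u]) (simp_all only: ab_id fst_conv snd_conv)
    next
      case c
      then show ?thesis using hU ab_u
        by (intro conjI bexI [of _ "h f2"] bexI [of _ "h f1"]) simp_all
    next
      case d
      then show ?thesis using hU ab_u
        by (intro conjI bexI [of _ "h f1"] bexI [of _ "h f2"]) simp_all
    qed
  qed
  define A where "A = {l. \<exists>v\<in>U. lshift v = l \<and> rshift v = 0}"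
  define B where "B = {r. \<exists>v\<in>U. lshift v = 0 \<and> rshift v = r}"
  have mem: "lshift u \<in> A" "rshift u \<in> B" if "u \<in> U" for u
    using split [OF that] unfolding A_def B_def by blast+
  have diff: "finv w \<in> U" "v \<circ> finv w \<in> U" "thompson_ab (v \<circ> finv w) = (lshift v - lshift w, rshift v - rshift w)"
    if "v \<in> U" "w \<in> U" for v w
  proof -
    show "finv w \<in> U" using U.m_inv_closed [OF that(2)] m_inv_thompson_F U_F that by simp
    then show "v \<circ> finv w \<in> U" using U.m_closed [of v "finv w"] that by simp
    show "thompson_ab (v \<circ> finv w) = (lshift v - lshift w, rshift v - rshift w)"
      using that U_F by (simp add: thompson_F_comp thompson_F_inv)
  qed
  \<comment> \<open>A power of the unit translation puts the positive integer \<open>M\<close> into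
    both \<open>A\<close> and \<open>B\<close>.\<close>
  have "unit_shift [^]\<^bsub>thompson_F\<^esub> M \<in> U" by (rule M(2) [OF unit_shift_in])
  then have "int M \<in> A" "int M \<in> B"
    using mem [of "unit_shift [^]\<^bsub>thompson_F\<^esub> M"] ab_pow [OF unit_shift_in, of M] ab_unit_shift
      by simp_all
  moreover have "x - y \<in> A" if xy: "x \<in> A" "y \<in> A" for x y
  proof -
    obtain v w where "v \<in> U" "w \<in> U" "rshift v = 0" "rshift w = 0" "x = lshift v" "y = lshift w"
      using xy unfolding A_def by blast
    then show ?thesis using diff [of v w] unfolding A_def
      by (intro CollectI bexI [of _ "v \<circ> finv w"]) simp_all
  qed
  moreover have "x - y \<in> B" if xy: "x \<in> B" "y \<in> B" for x y
  proof -
    obtain v w where "v \<in> U" "w \<in> U" "lshift v = 0" "lshift w = 0" "x = rshift v" "y = rshift w"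
      using xy unfolding B_def by blast
    then show ?thesis using diff [of v w] unfolding B_def
      by (intro CollectI bexI [of _ "v \<circ> finv w"]) simp_all
  qed
  ultimately obtain p q where pq: "p > 0" "A = range ((*) p)" "q > 0" "B = range ((*) q)"
    using int_subgroup_cyclic [of A "int M"] int_subgroup_cyclic [of B "int M"] M(1) by auto
  have "u \<in> thompson_sub p q" if u: "u \<in> U" for u
  proof -
    show ?thesis using mem [OF u] pq U_F [OF u] by (simp add: thompson_sub_def mem_Times_iff)
  qed
  moreover have "f \<in> U" if "f \<in> thompson_sub p q" for f
  proof -
    have f: "f \<in> carrier thompson_F" "lshift f \<in> A" "rshift f \<in> B"
      using that pq by (auto simp: thompson_sub_def mem_Times_iff)
    obtain v where v: "v \<in> U" "lshift v = lshift f" "rshift v = 0" using f(2) unfolding A_def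
      by auto
    obtain w where w: "w \<in> U" "rshift w = rshift f" "lshift w = 0" using f(3) unfolding B_def
      by auto
    have vw: "v \<circ> w \<in> U" using U.m_closed [OF v(1) w(1)] by simp
    have "thompson_ab (v \<circ> w) = (lshift f, rshift f)" using v w U_F by (simp add: thompson_F_comp)
    \<comment> \<open>The product of \<open>v\<close> and \<open>w\<close> has the end translations
      of \<open>f\<close>, so the two differ by an element of the kernel, which lies in
      \<open>U\<close>.\<close>
    then have "f \<circ> finv (v \<circ> w) \<in> ker_ab"
      using f(1) U_F [OF vw] by (simp add: ker_ab_def thompson_F_comp thompson_F_inv)
    then have "(f \<circ> finv (v \<circ> w)) \<circ> (v \<circ> w) \<in> U" using ker_U U.m_closed [OF _ vw, of "f \<circ> finv (v \<circ> w)"]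
      by auto
    moreover have "(f \<circ> finv (v \<circ> w)) \<circ> (v \<circ> w) = f"
      using inv_f_f [OF pl2_inj [OF thompson_F_D(1) [OF U_F [OF vw]]]] by (simp add: fun_eq_iff)
    ultimately show "f \<in> U" by simp
  qed
  ultimately have "U = thompson_sub p q" by blast
  then show ?thesis using pq by blast
qed

section \<open>Rescaling the two ends\<close>

text \<open>The knots of one period: the interval \<open>[0, p]\<close> is mapped onto \<open>[0, 1]\<close>, with the unit
  intervals going to intervals of length \<open>1/2, 1/4, \<dots>\<close>, the last two being of equal length.\<close>

definition periodic_knot :: "int \<Rightarrow> int \<Rightarrow> real" where
  "periodic_knot p j = of_int (j div p) + 1 - 1 / 2 ^ nat (j mod p)"

definition knot :: "int \<Rightarrow> int \<Rightarrow> int \<Rightarrow> real" where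
  "knot p q j = (if j \<ge> 0 then periodic_knot q j else periodic_knot p j)"

text \<open>The linear interpolation of the knots. It turns translation by \<open>q\<close> on the
  right and by \<open>p\<close> on the left into translation by 1.\<close>

definition rescale :: "int \<Rightarrow> int \<Rightarrow> real \<Rightarrow> real" where
  "rescale p q t = knot p q \<lfloor>t\<rfloor> + (knot p q (\<lfloor>t\<rfloor> + 1) - knot p q \<lfloor>t\<rfloor>) * (t - of_int \<lfloor>t\<rfloor>)"

lemma inverse_pow2_powi: "1 / (2::real) ^ n = 2 powi (- int n)"
  by (simp add: power_int_minus power_int_def field_simps)

text \<open>Inside a period each step halves the remaining gap to the next integer; the last step
  equals that gap.\<close>

lemma periodic_knot_step:
  assumes "p > 0" shows "\<exists>k::int. periodic_knot p (j + 1) - periodic_knot p j = 2 powi k"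
proof (cases "j mod p + 1 < p")
  case True
  have "j + 1 = (j div p) * p + (j mod p + 1)" by (simp add: div_mult_mod_eq)
  then have "(j + 1) div p = j div p" "(j + 1) mod p = j mod p + 1"
    using int_div_pos_eq [of "j + 1" p "j div p" "j mod p + 1"]
      int_mod_pos_eq [of "j + 1" p "j div p" "j mod p + 1"] True assms
        by (simp_all add: mult.commute)
  moreover have "nat (j mod p + 1) = Suc (nat (j mod p))" using assms by (simp add: nat_add_distrib)
  ultimately have "periodic_knot p (j + 1) - periodic_knot p j = 1 / 2 ^ Suc (nat (j mod p))"
    by (simp add: periodic_knot_def field_simps)
  then show ?thesis unfolding inverse_pow2_powi by blast
next
  case False
  then have eq: "j mod p + 1 = p" using pos_mod_bound [OF assms, of j] by linarith
  have "j + 1 = (j div p) * p + (j mod p + 1)" by (simp add: div_mult_mod_eq)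
  then have "j + 1 = (j div p + 1) * p" using eq by (simp add: ring_distribs)
  then have "(j + 1) div p = j div p + 1" "(j + 1) mod p = 0" using assms by simp_all
  then have "periodic_knot p (j + 1) - periodic_knot p j = 1 / 2 ^ (nat (j mod p))"
    by (simp add: periodic_knot_def)
  then show ?thesis unfolding inverse_pow2_powi by blast
qed

text \<open>Both periodic families vanish at 0, so the left formula also covers the right end of the
  unit interval from -1 to 0.\<close>

lemma knot_nonpos: "j \<le> 0 \<Longrightarrow> knot p q j = periodic_knot p j"
  by (cases "j = 0") (simp_all add: knot_def periodic_knot_def)

lemma knot_step:
  assumes "p > 0" "q > 0" shows "\<exists>k::int. knot p q (j + 1) - knot p q j = 2 powi k"
proof (cases "j \<ge> 0")
  case True
  then show ?thesis using periodic_knot_step [OF assms(2)] by (simp add: knot_def)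
next
  case False
  then show ?thesis using periodic_knot_step [OF assms(1)] by (simp add: knot_nonpos)
qed

lemma periodic_knot_add:
  assumes "p > 0" shows "periodic_knot p (j + p * n) = periodic_knot p j + of_int n"
  using assms by (simp add: periodic_knot_def)

lemma knot_dyadic: "knot p q j \<in> dyadic"
  unfolding knot_def periodic_knot_def inverse_pow2_powi by simp

lemma rescale_on_interval:
  assumes "of_int j \<le> t" "t \<le> of_int j + 1"
  shows "rescale p q t = knot p q j + (knot p q (j + 1) - knot p q j) * (t - of_int j)"
proof (cases "t = of_int j + 1")
  case True
  then have "\<lfloor>t\<rfloor> = j + 1" by simp
  then show ?thesis using True by (simp add: rescale_def)
next
  case False
  then have "\<lfloor>t\<rfloor> = j" using assms by (intro floor_unique) auto
  then show ?thesis by (simp add: rescale_def)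
qed

lemma rescale_add_right:
  assumes "q > 0" "t \<ge> 0" "t + of_int (q * n) \<ge> 0"
  shows "rescale p q (t + of_int (q * n)) = rescale p q t + of_int n"
proof -
  have fl: "\<lfloor>t + of_int (q * n)\<rfloor> = \<lfloor>t\<rfloor> + q * n" by (simp only: floor_add_int [symmetric])
  have "\<lfloor>t\<rfloor> \<ge> 0" "\<lfloor>t\<rfloor> + q * n \<ge> 0" using assms(2,3) fl by (metis zero_le_floor)+
  then have "knot p q (\<lfloor>t\<rfloor> + q * n + i) = knot p q (\<lfloor>t\<rfloor> + i) + of_int n" if "i \<ge> 0" for i
    using that periodic_knot_add [OF assms(1), of "\<lfloor>t\<rfloor> + i" n] by (simp add: knot_def ac_simps)
  from this [of 0] this [of 1] show ?thesis unfolding rescale_def fl by simp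
qed

lemma rescale_add_left:
  assumes "p > 0" "t < 0" "t + of_int (p * n) < 0"
  shows "rescale p q (t + of_int (p * n)) = rescale p q t + of_int n"
proof -
  have fl: "\<lfloor>t + of_int (p * n)\<rfloor> = \<lfloor>t\<rfloor> + p * n" by (simp only: floor_add_int [symmetric])
  have neg: "\<lfloor>t\<rfloor> < 0" "\<lfloor>t\<rfloor> + p * n < 0" using assms(2,3) fl by (metis floor_less_zero)+
  \<comment> \<open>For \<open>i = 1\<close> the index can reach 0, where the left formula still
    holds.\<close>
  have "knot p q (\<lfloor>t\<rfloor> + p * n + i) = knot p q (\<lfloor>t\<rfloor> + i) + of_int n" if "i \<le> 1" for i
  proof -
    have "\<lfloor>t\<rfloor> + i \<le> 0" "\<lfloor>t\<rfloor> + p * n + i \<le> 0" using neg that by linarith+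
    then show ?thesis
      using periodic_knot_add [OF assms(1), of "\<lfloor>t\<rfloor> + i" n] by (simp add: knot_nonpos ac_simps)
  qed
  from this [of 0] this [of 1] show ?thesis unfolding rescale_def fl by simp
qed

text \<open>The slopes are the knot steps, which are powers of 2, and the knots at multiples of the
  period are integers, whence unboundedness.\<close>

lemma rescale_pl2:
  assumes "p > 0" "q > 0" shows "rescale p q \<in> pl2"
proof (rule pl2_int_pieces)
  fix i :: int
  obtain k where k: "knot p q (i + 1) - knot p q i = 2 powi k" using knot_step [OF assms] by blast
  show "affine_piece (rescale p q) i"
    by (intro exI [of _ k] bexI [of _ "knot p q i - 2 powi k * of_int i"])
      (simp_all add: rescale_on_interval k knot_dyadic right_diff_distrib)
next
  fix z :: real
  have 0: "knot p q (q * n) = of_int n" if "n \<ge> 0" for n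
    using that periodic_knot_add [OF assms(2), of 0 n] assms(2)
      by (simp add: knot_def periodic_knot_def)
  have 1: "knot p q (p * n) = of_int n" if "n \<le> 0" for n
    using that periodic_knot_add [OF assms(1), of 0 n] assms(1)
    by (simp add: knot_nonpos mult_nonneg_nonpos periodic_knot_def)
  have "rescale p q (of_int (p * min 0 \<lfloor>z\<rfloor>)) \<le> z"
    using 1 [of "min 0 \<lfloor>z\<rfloor>"] unfolding rescale_def floor_of_int by simp linarith
  then show "\<exists>m::int. rescale p q (of_int m) \<le> z" by blast
  have "z < rescale p q (of_int (q * max 0 (\<lceil>z\<rceil> + 1)))"
    using 0 [of "max 0 (\<lceil>z\<rceil> + 1)"] unfolding rescale_def floor_of_int by simp linarith
  then show "\<exists>n::int. z < rescale p q (of_int n)" by blast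
qed

lemma rescale_conj_translations:
  assumes p: "p > 0" and q: "q > 0"
  shows "translation_left g (p * l) \<Longrightarrow> translation_left (rescale p q \<circ> g \<circ> finv (rescale p q)) l"
    and "translation_right g (q * r) \<Longrightarrow> translation_right (rescale p q \<circ> g \<circ> finv (rescale p q)) r"
    and "translation_left f l \<Longrightarrow> translation_left (finv (rescale p q) \<circ> f \<circ> rescale p q) (p * l)"
    and "translation_right f r \<Longrightarrow> translation_right (finv (rescale p q) \<circ> f \<circ> rescale p q) (q * r)"
proof -
  let ?v = "rescale p q"
  note v = rescale_pl2 [OF p q]
  note sm = strict_mono_less_eq [OF pl2_strict_mono [OF v]]
  note fv = surj_f_inv_f [OF pl2_surj [OF v]] and vf = inv_f_f [OF pl2_inj [OF v]]
  {
    assume "translation_left g (p * l)"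
    then obtain N where N: "\<forall>t\<le>N. g t = t + of_int (p * l)" by (auto simp: translation_left_iff)
    \<comment> \<open>Keeps both the point and its translate by \<open>p * l\<close> negative, as
      \<open>rescale_add_left\<close> requires.\<close>
    define N' where "N' = min N (min (-1) (- of_int (p * l) - 1))"
    have "?v (g (finv ?v s)) = s + of_int l" if "s \<le> ?v N'" for s
    proof -
      have "finv ?v s \<le> N'" using that sm [of "finv ?v s" N'] fv by simp
      then show ?thesis using N rescale_add_left [OF p, of "finv ?v s" l q] fv by (simp add: N'_def)
    qed
    then show "translation_left (?v \<circ> g \<circ> finv ?v) l" unfolding translation_left_iff by auto
  next
    assume "translation_right g (q * r)"
    then obtain N where N: "\<forall>t\<ge>N. g t = t + of_int (q * r)" by (auto simp: translation_right_iff)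
    define N' where "N' = max N (max 0 (- of_int (q * r)))"
    have "?v (g (finv ?v s)) = s + of_int r" if "s \<ge> ?v N'" for s
    proof -
      have "finv ?v s \<ge> N'" using that sm [of N' "finv ?v s"] fv by simp
      then show ?thesis using N rescale_add_right [OF q, of "finv ?v s" r p] fv
        by (simp add: N'_def)
    qed
    then show "translation_right (?v \<circ> g \<circ> finv ?v) r" unfolding translation_right_iff by auto
  next
    assume "translation_left f l"
    then obtain N where N: "\<forall>t\<le>N. f t = t + of_int l" by (auto simp: translation_left_iff)
    define N' where "N' = min (finv ?v N) (min (-1) (- of_int (p * l) - 1))"
    have "finv ?v (f (?v t)) = t + of_int (p * l)" if "t \<le> N'" for t
    proof -
      have "?v t \<le> N" using that sm [of t "finv ?v N"] fv by (simp add: N'_def)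
      then have "f (?v t) = ?v (t + of_int (p * l))"
        using N that rescale_add_left [OF p, of t l q] by (simp add: N'_def)
      then show ?thesis using vf by metis
    qed
    then show "translation_left (finv ?v \<circ> f \<circ> ?v) (p * l)" unfolding translation_left_iff by auto
  next
    assume "translation_right f r"
    then obtain N where N: "\<forall>t\<ge>N. f t = t + of_int r" by (auto simp: translation_right_iff)
    define N' where "N' = max (finv ?v N) (max 0 (- of_int (q * r)))"
    have "finv ?v (f (?v t)) = t + of_int (q * r)" if "t \<ge> N'" for t
    proof -
      have "?v t \<ge> N" using that sm [of "finv ?v N" t] fv by (simp add: N'_def)
      then have "f (?v t) = ?v (t + of_int (q * r))"
        using N that rescale_add_right [OF q, of t r p] by (simp add: N'_def)
      then show ?thesis using vf by metis
    qed
    then show "translation_right (finv ?v \<circ> f \<circ> ?v) (q * r)" unfolding translation_right_iff by auto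
  }
qed

text \<open>Conjugation \<open>c\<close> by the rescaling map divides the left translation by
  \<open>p\<close> and the right one by \<open>q\<close>; the opposite conjugation \<open>d\<close>
  multiplies them back.\<close>

lemma thompson_sub_iso:
  assumes "p > 0" "q > 0" shows "thompson_F\<lparr>carrier := thompson_sub p q\<rparr> \<cong> thompson_F"
proof -
  let ?v = "rescale p q"
  note v = rescale_pl2 [OF assms]
  note fv = surj_f_inv_f [OF pl2_surj [OF v]] and vf = inv_f_f [OF pl2_inj [OF v]]
  define c where "c g = ?v \<circ> g \<circ> finv ?v" for g
  define d where "d f = finv ?v \<circ> f \<circ> ?v" for f
  have cF: "c g \<in> carrier thompson_F" if g: "g \<in> thompson_sub p q" for g
  proof -
    obtain l r where lr: "lshift g = p * l" "rshift g = q * r" and gF: "g \<in> carrier thompson_F"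
      using g by (auto simp: thompson_sub_def mem_Times_iff)
    have "c g \<in> pl2" unfolding c_def using v pl2_inv [OF v] thompson_F_D(1) [OF gF] pl2_comp
      by blast
    then show ?thesis
      using thompson_F_I(1) rescale_conj_translations(1,2) [OF assms, of g]
        thompson_F_D(2,3) [OF gF] unfolding c_def lr by blast
  qed
  have dF: "d f \<in> thompson_sub p q" if f: "f \<in> carrier thompson_F" for f
  proof -
    have "d f \<in> pl2" unfolding d_def using v pl2_inv [OF v] thompson_F_D(1) [OF f] pl2_comp by blast
    then have "d f \<in> carrier thompson_F" "thompson_ab (d f) = (p * lshift f, q * rshift f)"
      using thompson_F_I rescale_conj_translations(3,4) [OF assms]
        thompson_F_D(2,3) [OF f] unfolding d_def by blast+
    then show ?thesis by (simp add: thompson_sub_def rangeI)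
  qed
  have "bij_betw c (thompson_sub p q) (carrier thompson_F)"
    by (rule bij_betw_byWitness [where f' = d]) (auto simp: c_def d_def fun_eq_iff fv vf cF [unfolded c_def] dF [unfolded d_def])
  moreover have "c (f \<circ> g) = c f \<circ> c g" for f g by (simp add: c_def fun_eq_iff vf)
  ultimately have "c \<in> iso (thompson_F\<lparr>carrier := thompson_sub p q\<rparr>) thompson_F"
    using cF by (auto simp: iso_def hom_def)
  then show ?thesis unfolding is_iso_def by blast
qed

theorem corollary3p3:
  fixes U :: "(real \<Rightarrow> real) set"
  assumes "subgroup U thompson_F"
    and "finite (rcosets\<^bsub>thompson_F\<^esub> U)"
  shows "thompson_F\<lparr>carrier := U\<rparr> \<cong> thompson_F \<longleftrightarrow>
    (\<exists>p q :: int. p > 0 \<and> q > 0 \<and> U = thompson_sub p q)"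
  using finite_index_iso_imp_rectangular [OF assms] thompson_sub_iso by blast

end
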